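(* Let $X,Y$ be complex Banach spaces. (a) For every $f\in\mathcal{H}L(B_X,Y)$ there exists a unique $T_f\in\mathcal L(\mathcal G(B_X),Y)$ such that $f=T_f\circ\delta$, and $$\tfrac12\|f\|_L\le\max\{L(f),\|f(0)\|\}\le\|T_f\|\le\|f\|_L.$$ (b) The map $f\mapsto T_f$ is surjective (onto $\mathcal L(\mathcal G(B_X),Y)$) and linear. In particular, $\mathcal{H}L(B_X,Y)\cong\mathcal L(\mathcal G(B_X),Y)$ and $\mathcal{H}L(B_X)\cong\mathcal G(B_X)^*$. (c) The topologies $w^*$, $\tau_0$ and $\tau_p$ coincide on $r\overline{B}_{\mathcal{H}L(B_X)}$, for any $r>0$. (d) For any $r>0$, $$\mathcal G(B_X)=\{\varphi\in\mathcal{H}L(B_X)^*:\varphi|_{r\overline{B}_{\mathcal{H}L(B_X)}}\text{ is }\tau_0\text{-continuous}\}=\{\varphi\in\mathcal{H}L(B_X)^*:\varphi|_{r\overline{B}_{\mathcal{H}L(B_X)}}\text{ is }\tau_p\text{-continuous}\}.$$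
   Context: $B_X$ denotes the open unit ball of $X$. $\mathcal{H}L(B_X,Y)$ is the Banach space of all Lipschitz maps $f\colon B_X\to Y$ that are holomorphic on $B_X$, with norm $\|f\|_L=L(f)+\|f(0)\|$, where $L(f)$ is the Lipschitz constant; $\mathcal{H}L(B_X)=\mathcal{H}L(B_X,\mathbb C)$, with closed unit ball $\overline{B}_{\mathcal{H}L(B_X)}$. For $x\in B_X$, $\delta(x)\in\mathcal{H}L(B_X)^*$ is the evaluation functional $f\mapsto f(x)$, giving a map $\delta\colon B_X\to\mathcal{H}L(B_X)^*$, and $\mathcal G(B_X)=\overline{\operatorname{span}}\,\delta(B_X)\subseteq\mathcal{H}L(B_X)^*$ (norm closure). $\mathcal L(E,F)$ is the space of bounded linear operators from $E$ to $F$, and $\cong$ means isomorphic as Banach spaces (via $f\mapsto T_f$). $w^*$ is the weak$^*$ topology on $\mathcal{H}L(B_X)$ coming from the predual $\mathcal G(B_X)$, $\tau_0$ is the topology of uniform convergence on compact subsets of $B_X$, and $\tau_p$ is the topology of pointwise convergence on $B_X$. *)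

theory Defs
  imports "HOL-Analysis.Analysis"
begin

section \<open>Complex normed and Banach spaces\<close>

class scaleC = scaleR +
  fixes scaleC :: "complex \<Rightarrow> 'a \<Rightarrow> 'a" (infixr \<open>*\<^sub>C\<close> 75)

class complex_normed_vector = scaleC + real_normed_vector +
  assumes scaleC_add_right: "c *\<^sub>C (x + y) = c *\<^sub>C x + c *\<^sub>C y"
    and scaleC_add_left: "(c + d) *\<^sub>C x = c *\<^sub>C x + d *\<^sub>C x"
    and scaleC_scaleC [simp]: "c *\<^sub>C d *\<^sub>C x = (c * d) *\<^sub>C x"
    and scaleC_of_real: "complex_of_real r *\<^sub>C x = r *\<^sub>R x"
    and norm_scaleC [simp]: "norm (c *\<^sub>C x) = cmod c * norm x"

class complex_banach = complex_normed_vector + banach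

lemma scaleC_one [simp]: "1 *\<^sub>C x = (x :: 'a::complex_normed_vector)"
  using scaleC_of_real[of 1 x] by simp

interpretation complex_vector:
  vector_space "scaleC :: complex \<Rightarrow> 'a \<Rightarrow> 'a::complex_normed_vector"
  by standard (simp_all add: scaleC_add_right scaleC_add_left)

abbreviation cspan :: "'a::complex_normed_vector set \<Rightarrow> 'a set"
  where "cspan \<equiv> complex_vector.span"

lemma scaleC_right_bounded_linear:
  "bounded_linear (\<lambda>x :: 'a::complex_normed_vector. c *\<^sub>C x)"
proof (rule bounded_linear_intro[where K = "cmod c"])
  fix r :: real and x :: 'a
  show "c *\<^sub>C r *\<^sub>R x = r *\<^sub>R c *\<^sub>C x"
    by (simp add: scaleC_of_real[symmetric] mult.commute)
qed (simp_all add: scaleC_add_right mult.commute)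

instantiation complex :: complex_banach
begin

definition scaleC_complex :: "complex \<Rightarrow> complex \<Rightarrow> complex"
  where "scaleC_complex c z = c * z"

instance
  by standard (simp_all add: scaleC_complex_def algebra_simps scaleR_conv_of_real norm_mult)

end


section \<open>Bounded complex-linear operators\<close>

definition bounded_clinear :: "('a::complex_normed_vector \<Rightarrow> 'b::complex_normed_vector) \<Rightarrow> bool"
  where "bounded_clinear f \<longleftrightarrow> bounded_linear f \<and> (\<forall>c x. f (c *\<^sub>C x) = c *\<^sub>C f x)"

lemma bounded_clinear_0: "bounded_clinear (\<lambda>x. 0)"
  by (simp add: bounded_clinear_def)

lemma bounded_clinear_add:
  "bounded_clinear f \<Longrightarrow> bounded_clinear g \<Longrightarrow> bounded_clinear (\<lambda>x. f x + g x)"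
  by (simp add: bounded_clinear_def bounded_linear_add scaleC_add_right)

lemma bounded_clinear_scaleC: "bounded_clinear f \<Longrightarrow> bounded_clinear (\<lambda>x. c *\<^sub>C f x)"
  by (auto simp: bounded_clinear_def mult.commute
      intro: bounded_linear_compose[OF scaleC_right_bounded_linear])

lemma bounded_clinear_scaleR: "bounded_clinear f \<Longrightarrow> bounded_clinear (\<lambda>x. r *\<^sub>R f x)"
  using bounded_clinear_scaleC[of f "complex_of_real r"] by (simp add: scaleC_of_real)

lemma bounded_clinear_minus: "bounded_clinear f \<Longrightarrow> bounded_clinear (\<lambda>x. - f x)"
  using bounded_clinear_scaleR[of f "-1"] by simp

lemma bounded_clinear_diff:
  "bounded_clinear f \<Longrightarrow> bounded_clinear g \<Longrightarrow> bounded_clinear (\<lambda>x. f x - g x)"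
  using bounded_clinear_add[OF _ bounded_clinear_minus, of f g] by simp

lemma bounded_clinear_limit:
  assumes "\<And>n. bounded_clinear (f n)" "bounded_linear g" "\<And>x. (\<lambda>n. f n x) \<longlonglongrightarrow> g x"
  shows "bounded_clinear g"
  unfolding bounded_clinear_def
proof (intro conjI allI)
  fix c x
  have "(\<lambda>n. f n (c *\<^sub>C x)) \<longlonglongrightarrow> c *\<^sub>C g x"
    using bounded_linear.tendsto[OF scaleC_right_bounded_linear assms(3)] assms(1)
    by (simp add: bounded_clinear_def)
  then show "g (c *\<^sub>C x) = c *\<^sub>C g x"
    using assms(3) LIMSEQ_unique by blast
qed (rule assms(2))

typedef (overloaded) ('a, 'b) clinfun (\<open>(\<open>notation=\<open>infix \<Rightarrow>\<^sub>C\<^sub>L\<close>\<close>_ \<Rightarrow>\<^sub>C\<^sub>L /_)\<close> [22, 21] 21) =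
  "{f :: 'a::complex_normed_vector \<Rightarrow> 'b::complex_normed_vector. bounded_clinear f}"
  morphisms clinfun_apply Clinfun
  using bounded_clinear_0 by blast

setup_lifting type_definition_clinfun

lemma clinfun_eqI: "(\<And>x. clinfun_apply f x = clinfun_apply g x) \<Longrightarrow> f = g"
  by transfer auto

instantiation clinfun :: (complex_normed_vector, complex_normed_vector) complex_normed_vector
begin

lift_definition norm_clinfun :: "'a \<Rightarrow>\<^sub>C\<^sub>L 'b \<Rightarrow> real" is onorm .

lift_definition zero_clinfun :: "'a \<Rightarrow>\<^sub>C\<^sub>L 'b" is "\<lambda>x. 0"
  by (rule bounded_clinear_0)

lift_definition plus_clinfun :: "'a \<Rightarrow>\<^sub>C\<^sub>L 'b \<Rightarrow> 'a \<Rightarrow>\<^sub>C\<^sub>L 'b \<Rightarrow> 'a \<Rightarrow>\<^sub>C\<^sub>L 'b" is "\<lambda>f g x. f x + g x"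
  by (rule bounded_clinear_add)

lift_definition minus_clinfun :: "'a \<Rightarrow>\<^sub>C\<^sub>L 'b \<Rightarrow> 'a \<Rightarrow>\<^sub>C\<^sub>L 'b \<Rightarrow> 'a \<Rightarrow>\<^sub>C\<^sub>L 'b" is "\<lambda>f g x. f x - g x"
  by (rule bounded_clinear_diff)

lift_definition uminus_clinfun :: "'a \<Rightarrow>\<^sub>C\<^sub>L 'b \<Rightarrow> 'a \<Rightarrow>\<^sub>C\<^sub>L 'b" is "\<lambda>f x. - f x"
  by (rule bounded_clinear_minus)

lift_definition scaleR_clinfun :: "real \<Rightarrow> 'a \<Rightarrow>\<^sub>C\<^sub>L 'b \<Rightarrow> 'a \<Rightarrow>\<^sub>C\<^sub>L 'b" is "\<lambda>r f x. r *\<^sub>R f x"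
  by (rule bounded_clinear_scaleR)

lift_definition scaleC_clinfun :: "complex \<Rightarrow> 'a \<Rightarrow>\<^sub>C\<^sub>L 'b \<Rightarrow> 'a \<Rightarrow>\<^sub>C\<^sub>L 'b" is "\<lambda>c f x. c *\<^sub>C f x"
  by (rule bounded_clinear_scaleC)

definition dist_clinfun :: "'a \<Rightarrow>\<^sub>C\<^sub>L 'b \<Rightarrow> 'a \<Rightarrow>\<^sub>C\<^sub>L 'b \<Rightarrow> real"
  where "dist_clinfun f g = norm (f - g)"

definition sgn_clinfun :: "'a \<Rightarrow>\<^sub>C\<^sub>L 'b \<Rightarrow> 'a \<Rightarrow>\<^sub>C\<^sub>L 'b"
  where "sgn_clinfun f = inverse (norm f) *\<^sub>R f"

definition uniformity_clinfun :: "(('a \<Rightarrow>\<^sub>C\<^sub>L 'b) \<times> ('a \<Rightarrow>\<^sub>C\<^sub>L 'b)) filter"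
  where "uniformity_clinfun = (INF e\<in>{0<..}. principal {(f, g). dist f g < e})"

definition open_clinfun :: "('a \<Rightarrow>\<^sub>C\<^sub>L 'b) set \<Rightarrow> bool"
  where "open_clinfun S = (\<forall>f\<in>S. \<forall>\<^sub>F (f', g) in uniformity. f' = f \<longrightarrow> g \<in> S)"

instance
proof
  fix f g h :: "'a \<Rightarrow>\<^sub>C\<^sub>L 'b" and r s :: real and c d :: complex and S :: "('a \<Rightarrow>\<^sub>C\<^sub>L 'b) set"
  show "dist f g = norm (f - g)" by (rule dist_clinfun_def)
  show "sgn f = inverse (norm f) *\<^sub>R f" by (rule sgn_clinfun_def)
  show "uniformity = (INF e\<in>{0<..}. principal {(f, g :: 'a \<Rightarrow>\<^sub>C\<^sub>L 'b). dist f g < e})"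
    by (rule uniformity_clinfun_def)
  show "open S = (\<forall>f\<in>S. \<forall>\<^sub>F (f', g) in uniformity. f' = f \<longrightarrow> g \<in> S)"
    by (rule open_clinfun_def)
  show "f + g + h = f + (g + h)" "f + g = g + f" "0 + f = f" "- f + f = 0" "f - g = f + - g"
    by (transfer, simp add: algebra_simps)+
  show "r *\<^sub>R (f + g) = r *\<^sub>R f + r *\<^sub>R g" "(r + s) *\<^sub>R f = r *\<^sub>R f + s *\<^sub>R f"
    "r *\<^sub>R s *\<^sub>R f = (r * s) *\<^sub>R f" "1 *\<^sub>R f = f"
    by (transfer, simp add: algebra_simps)+
  show "norm f = 0 \<longleftrightarrow> f = 0"
    by transfer (auto simp: bounded_clinear_def onorm_eq_0)
  show "norm (f + g) \<le> norm f + norm g"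
    by transfer (auto simp: bounded_clinear_def onorm_triangle)
  show "norm (r *\<^sub>R f) = \<bar>r\<bar> * norm f"
    by transfer (auto simp: bounded_clinear_def onorm_scaleR)
  show "c *\<^sub>C (f + g) = c *\<^sub>C f + c *\<^sub>C g" "(c + d) *\<^sub>C f = c *\<^sub>C f + d *\<^sub>C f"
    "c *\<^sub>C d *\<^sub>C f = (c * d) *\<^sub>C f" "complex_of_real r *\<^sub>C f = r *\<^sub>R f"
    by (transfer, simp add: scaleC_add_right scaleC_add_left scaleC_of_real)+
  show "norm (c *\<^sub>C f) = cmod c * norm f"
  proof transfer
    fix c and f :: "'a \<Rightarrow> 'b"
    assume "bounded_clinear f"
    then have f: "bounded_linear f" by (simp add: bounded_clinear_def)
    have "onorm (\<lambda>x. c *\<^sub>C f x) = onorm (\<lambda>x. cmod c *\<^sub>R f x)"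
      by (simp add: onorm_def)
    then show "onorm (\<lambda>x. c *\<^sub>C f x) = cmod c * onorm f"
      using onorm_scaleR[OF f, of "cmod c"] by simp
  qed
qed

end

lemma bounded_clinear_clinfun_apply: "bounded_clinear (clinfun_apply f)"
  using clinfun_apply[of f] by simp

lemma norm_clinfun: "norm (clinfun_apply f x) \<le> norm f * norm x"
  by transfer (simp add: bounded_clinear_def onorm)

lemma norm_clinfun_bound:
  "0 \<le> b \<Longrightarrow> (\<And>x. norm (clinfun_apply f x) \<le> b * norm x) \<Longrightarrow> norm f \<le> b"
  by transfer (rule onorm_bound)

instance clinfun :: (complex_normed_vector, complex_banach) complex_banach
proof
  fix X :: "nat \<Rightarrow> 'a \<Rightarrow>\<^sub>C\<^sub>L 'b"
  assume X: "Cauchy X"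
  define Y where "Y n = Blinfun (clinfun_apply (X n))" for n
  have Y: "blinfun_apply (Y n) = clinfun_apply (X n)" for n
    using bounded_clinear_clinfun_apply[of "X n"]
    by (simp add: Y_def bounded_clinear_def bounded_linear_Blinfun_apply)
  have normY: "norm (Y m - Y n) = norm (X m - X n)" for m n
    by (simp add: norm_blinfun.rep_eq norm_clinfun.rep_eq minus_blinfun.rep_eq
        minus_clinfun.rep_eq Y)
  have "Cauchy Y"
    using X by (simp add: Cauchy_def dist_norm normY)
  then obtain g where g: "Y \<longlonglongrightarrow> g"
    using Cauchy_convergent convergent_def by blast
  have "bounded_clinear (blinfun_apply g)"
  proof (rule bounded_clinear_limit)
    show "bounded_clinear (clinfun_apply (X n))" for n
      by (rule bounded_clinear_clinfun_apply)
    show "(\<lambda>n. clinfun_apply (X n) x) \<longlonglongrightarrow> blinfun_apply g x" for x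
      using blinfun.tendsto[OF g tendsto_const, of x] by (simp add: Y)
  qed (rule blinfun.bounded_linear_right)
  then have h: "clinfun_apply (Clinfun (blinfun_apply g)) = blinfun_apply g"
    by (simp add: Clinfun_inverse)
  have "norm (X n - Clinfun (blinfun_apply g)) = norm (Y n - g)" for n
    by (simp add: norm_blinfun.rep_eq norm_clinfun.rep_eq minus_blinfun.rep_eq
        minus_clinfun.rep_eq Y h)
  then have "X \<longlonglongrightarrow> Clinfun (blinfun_apply g)"
    using g by (simp add: LIMSEQ_iff)
  then show "convergent X"
    by (rule convergentI)
qed

definition banach_isomorphism ::
    "('a::complex_banach \<Rightarrow> 'b::complex_banach) \<Rightarrow> bool"
  where "banach_isomorphism f \<longleftrightarrow> bounded_clinear f \<and> bij f \<and> bounded_clinear (inv f)"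


section \<open>Holomorphic Lipschitz maps on the open unit ball\<close>

definition holomorphic_map_on ::
    "('a::complex_normed_vector \<Rightarrow> 'b::complex_normed_vector) \<Rightarrow> 'a set \<Rightarrow> bool"
  where "holomorphic_map_on f U \<longleftrightarrow>
    (\<forall>x\<in>U. \<exists>D. bounded_clinear D \<and> (f has_derivative D) (at x))"

definition lipschitz_const :: "('a::real_normed_vector \<Rightarrow> 'b::real_normed_vector) \<Rightarrow> real"
  where "lipschitz_const f = Inf {C. C-lipschitz_on (ball 0 1) f}"

lemma lipschitz_const_le: "C-lipschitz_on (ball 0 1) f \<Longrightarrow> lipschitz_const f \<le> C"
  unfolding lipschitz_const_def
  by (rule cInf_lower) (auto intro: bdd_belowI[where m = 0] lipschitz_on_nonneg)

lemma lipschitz_const: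
  assumes "C-lipschitz_on (ball 0 1) f"
  shows "(lipschitz_const f)-lipschitz_on (ball 0 1) f"
proof (rule lipschitz_onI)
  show "0 \<le> lipschitz_const f"
    unfolding lipschitz_const_def
    by (rule cInf_greatest) (use assms in \<open>auto intro: lipschitz_on_nonneg\<close>)
  fix x y :: 'a
  assume xy: "x \<in> ball 0 1" "y \<in> ball 0 1"
  show "dist (f x) (f y) \<le> lipschitz_const f * dist x y"
  proof (cases "x = y")
    case False
    have "dist (f x) (f y) / dist x y \<le> lipschitz_const f"
      unfolding lipschitz_const_def
    proof (rule cInf_greatest)
      show "{C. C-lipschitz_on (ball 0 1) f} \<noteq> {}" using assms by auto
      fix K assume "K \<in> {C. C-lipschitz_on (ball 0 1) f}"
      then show "dist (f x) (f y) / dist x y \<le> K"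
        using lipschitz_onD[of K _ f, OF _ xy] False by (simp add: divide_simps)
    qed
    then show ?thesis using False by (simp add: divide_simps)
  qed simp
qed

lemma lipschitz_on_scaleC:
  fixes f :: "'a::real_normed_vector \<Rightarrow> 'b::complex_normed_vector"
  assumes "C-lipschitz_on S f"
  shows "(cmod c * C)-lipschitz_on S (\<lambda>x. c *\<^sub>C f x)"
proof (rule lipschitz_onI)
  fix x y assume "x \<in> S" "y \<in> S"
  then have "cmod c * dist (f x) (f y) \<le> cmod c * (C * dist x y)"
    using lipschitz_onD[OF assms] by (intro mult_left_mono) auto
  moreover have "dist (c *\<^sub>C f x) (c *\<^sub>C f y) = cmod c * dist (f x) (f y)"
    by (metis complex_vector.scale_right_diff_distrib dist_norm norm_scaleC)
  ultimately show "dist (c *\<^sub>C f x) (c *\<^sub>C f y) \<le> cmod c * C * dist x y"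
    by (simp add: mult.assoc)
qed (use lipschitz_on_nonneg[OF assms] in auto)

lemma holomorphic_map_on_add:
  assumes "holomorphic_map_on f U" "holomorphic_map_on g U"
  shows "holomorphic_map_on (\<lambda>x. f x + g x) U"
  unfolding holomorphic_map_on_def
proof
  fix x assume x: "x \<in> U"
  obtain D E where "bounded_clinear D" "(f has_derivative D) (at x)"
    "bounded_clinear E" "(g has_derivative E) (at x)"
    using assms x unfolding holomorphic_map_on_def by metis
  then show "\<exists>D. bounded_clinear D \<and> ((\<lambda>x. f x + g x) has_derivative D) (at x)"
    by (intro exI[of _ "\<lambda>h. D h + E h"] conjI bounded_clinear_add has_derivative_add)
qed

lemma holomorphic_map_on_scaleC:
  assumes "holomorphic_map_on f U"
  shows "holomorphic_map_on (\<lambda>x. c *\<^sub>C f x) U"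
  unfolding holomorphic_map_on_def
proof
  fix x assume x: "x \<in> U"
  obtain D where "bounded_clinear D" "(f has_derivative D) (at x)"
    using assms x unfolding holomorphic_map_on_def by metis
  then show "\<exists>D. bounded_clinear D \<and> ((\<lambda>x. c *\<^sub>C f x) has_derivative D) (at x)"
    by (intro exI[of _ "\<lambda>h. c *\<^sub>C D h"] conjI bounded_clinear_scaleC
        bounded_linear.has_derivative[OF scaleC_right_bounded_linear])
qed

text \<open>A map on the open unit ball is represented by its extension by zero to the whole space,
  so that equality of representatives is equality on the ball.\<close>

definition holomorphic_lipschitz ::
    "('a::complex_normed_vector \<Rightarrow> 'b::complex_normed_vector) \<Rightarrow> bool"
  where "holomorphic_lipschitz f \<longleftrightarrow>
    (\<exists>C. C-lipschitz_on (ball 0 1) f) \<and> holomorphic_map_on f (ball 0 1) \<and>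
    (\<forall>x. x \<notin> ball 0 1 \<longrightarrow> f x = 0)"

lemma holomorphic_lipschitz_lipschitz_const:
  "holomorphic_lipschitz f \<Longrightarrow> (lipschitz_const f)-lipschitz_on (ball 0 1) f"
  unfolding holomorphic_lipschitz_def by (elim conjE exE) (rule lipschitz_const)

lemma holomorphic_lipschitz_holomorphic:
  "holomorphic_lipschitz f \<Longrightarrow> holomorphic_map_on f (ball 0 1)"
  unfolding holomorphic_lipschitz_def by blast

lemma holomorphic_lipschitz_outside:
  "holomorphic_lipschitz f \<Longrightarrow> x \<notin> ball 0 1 \<Longrightarrow> f x = 0"
  unfolding holomorphic_lipschitz_def by blast

lemma holomorphic_lipschitz_0:
  "holomorphic_lipschitz (\<lambda>x :: 'a::complex_normed_vector. 0 :: 'b::complex_normed_vector)"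
proof -
  have "0-lipschitz_on (ball 0 1) (\<lambda>x :: 'a. 0 :: 'b)"
    by (rule lipschitz_onI) auto
  moreover have "holomorphic_map_on (\<lambda>x :: 'a. 0 :: 'b) (ball 0 1)"
    unfolding holomorphic_map_on_def
    by (intro ballI exI[of _ "\<lambda>x. 0"] conjI bounded_clinear_0 has_derivative_const)
  ultimately show ?thesis unfolding holomorphic_lipschitz_def
    by (intro conjI exI allI impI refl)
qed

lemma holomorphic_lipschitz_add:
  assumes "holomorphic_lipschitz f" "holomorphic_lipschitz g"
  shows "holomorphic_lipschitz (\<lambda>x. f x + g x)"
  unfolding holomorphic_lipschitz_def
proof (intro conjI exI allI impI)
  show "(lipschitz_const f + lipschitz_const g)-lipschitz_on (ball 0 1) (\<lambda>x. f x + g x)"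
    by (intro lipschitz_on_add holomorphic_lipschitz_lipschitz_const assms)
  show "holomorphic_map_on (\<lambda>x. f x + g x) (ball 0 1)"
    by (intro holomorphic_map_on_add holomorphic_lipschitz_holomorphic assms)
  show "f x + g x = 0" if "x \<notin> ball 0 1" for x
    using assms[THEN holomorphic_lipschitz_outside, OF that] by simp
qed

lemma holomorphic_lipschitz_scaleC:
  assumes "holomorphic_lipschitz f"
  shows "holomorphic_lipschitz (\<lambda>x. c *\<^sub>C f x)"
  unfolding holomorphic_lipschitz_def
proof (intro conjI exI allI impI)
  show "(cmod c * lipschitz_const f)-lipschitz_on (ball 0 1) (\<lambda>x. c *\<^sub>C f x)"
    by (intro lipschitz_on_scaleC holomorphic_lipschitz_lipschitz_const assms)
  show "holomorphic_map_on (\<lambda>x. c *\<^sub>C f x) (ball 0 1)"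
    by (intro holomorphic_map_on_scaleC holomorphic_lipschitz_holomorphic assms)
  show "c *\<^sub>C f x = 0" if "x \<notin> ball 0 1" for x
    using assms[THEN holomorphic_lipschitz_outside, OF that] by simp
qed

lemma holomorphic_lipschitz_scaleR:
  "holomorphic_lipschitz f \<Longrightarrow> holomorphic_lipschitz (\<lambda>x. r *\<^sub>R f x)"
  using holomorphic_lipschitz_scaleC[of f "complex_of_real r"] by (simp add: scaleC_of_real)

lemma holomorphic_lipschitz_minus:
  "holomorphic_lipschitz f \<Longrightarrow> holomorphic_lipschitz (\<lambda>x. - f x)"
  using holomorphic_lipschitz_scaleR[of f "-1"] by simp

typedef (overloaded) ('a, 'b) hollip =
  "{f :: 'a::complex_normed_vector \<Rightarrow> 'b::complex_normed_vector. holomorphic_lipschitz f}"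
  morphisms hollip_apply Hollip
  using holomorphic_lipschitz_0 by blast

setup_lifting type_definition_hollip

lemma holomorphic_lipschitz_hollip_apply: "holomorphic_lipschitz (hollip_apply f)"
  using hollip_apply[of f] by simp

lemma hollip_lipschitz:
  "(lipschitz_const (hollip_apply f))-lipschitz_on (ball 0 1) (hollip_apply f)"
  by (rule holomorphic_lipschitz_lipschitz_const[OF holomorphic_lipschitz_hollip_apply])

lemma hollip_eqI:
  assumes "\<And>x. x \<in> ball 0 1 \<Longrightarrow> hollip_apply f x = hollip_apply g x"
  shows "f = g"
proof -
  have "hollip_apply f x = hollip_apply g x" for x
  proof (cases "x \<in> ball 0 1")
    case False
    then show ?thesis
      by (simp add: holomorphic_lipschitz_outside[OF holomorphic_lipschitz_hollip_apply])
  qed (rule assms)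
  then show ?thesis by (simp add: hollip_apply_inject[symmetric] fun_eq_iff)
qed

instantiation hollip :: (complex_normed_vector, complex_normed_vector) complex_normed_vector
begin

lift_definition norm_hollip :: "('a, 'b) hollip \<Rightarrow> real"
  is "\<lambda>f. lipschitz_const f + norm (f 0)" .

lift_definition zero_hollip :: "('a, 'b) hollip" is "\<lambda>x. 0"
  by (rule holomorphic_lipschitz_0)

lift_definition plus_hollip :: "('a, 'b) hollip \<Rightarrow> ('a, 'b) hollip \<Rightarrow> ('a, 'b) hollip"
  is "\<lambda>f g x. f x + g x"
  by (rule holomorphic_lipschitz_add)

lift_definition uminus_hollip :: "('a, 'b) hollip \<Rightarrow> ('a, 'b) hollip" is "\<lambda>f x. - f x"
  by (rule holomorphic_lipschitz_minus)

lift_definition minus_hollip :: "('a, 'b) hollip \<Rightarrow> ('a, 'b) hollip \<Rightarrow> ('a, 'b) hollip"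
  is "\<lambda>f g x. f x - g x"
  using holomorphic_lipschitz_add[OF _ holomorphic_lipschitz_minus] by fastforce

lift_definition scaleR_hollip :: "real \<Rightarrow> ('a, 'b) hollip \<Rightarrow> ('a, 'b) hollip"
  is "\<lambda>r f x. r *\<^sub>R f x"
  by (rule holomorphic_lipschitz_scaleR)

lift_definition scaleC_hollip :: "complex \<Rightarrow> ('a, 'b) hollip \<Rightarrow> ('a, 'b) hollip"
  is "\<lambda>c f x. c *\<^sub>C f x"
  by (rule holomorphic_lipschitz_scaleC)

definition dist_hollip :: "('a, 'b) hollip \<Rightarrow> ('a, 'b) hollip \<Rightarrow> real"
  where "dist_hollip f g = norm (f - g)"

definition sgn_hollip :: "('a, 'b) hollip \<Rightarrow> ('a, 'b) hollip"
  where "sgn_hollip f = inverse (norm f) *\<^sub>R f"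

definition uniformity_hollip :: "(('a, 'b) hollip \<times> ('a, 'b) hollip) filter"
  where "uniformity_hollip = (INF e\<in>{0<..}. principal {(f, g). dist f g < e})"

definition open_hollip :: "('a, 'b) hollip set \<Rightarrow> bool"
  where "open_hollip S = (\<forall>f\<in>S. \<forall>\<^sub>F (f', g) in uniformity. f' = f \<longrightarrow> g \<in> S)"

instance
proof
  fix f g h :: "('a, 'b) hollip" and r s :: real and c d :: complex and S :: "('a, 'b) hollip set"
  show "dist f g = norm (f - g)" by (rule dist_hollip_def)
  show "sgn f = inverse (norm f) *\<^sub>R f" by (rule sgn_hollip_def)
  show "uniformity = (INF e\<in>{0<..}. principal {(f, g :: ('a, 'b) hollip). dist f g < e})"
    by (rule uniformity_hollip_def)
  show "open S = (\<forall>f\<in>S. \<forall>\<^sub>F (f', g) in uniformity. f' = f \<longrightarrow> g \<in> S)"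
    by (rule open_hollip_def)
  show "f + g + h = f + (g + h)" "f + g = g + f" "0 + f = f" "- f + f = 0" "f - g = f + - g"
    by (transfer, simp add: algebra_simps)+
  show "r *\<^sub>R (f + g) = r *\<^sub>R f + r *\<^sub>R g" "(r + s) *\<^sub>R f = r *\<^sub>R f + s *\<^sub>R f"
    "r *\<^sub>R s *\<^sub>R f = (r * s) *\<^sub>R f" "1 *\<^sub>R f = f"
    by (transfer, simp add: algebra_simps)+
  show "c *\<^sub>C (f + g) = c *\<^sub>C f + c *\<^sub>C g" "(c + d) *\<^sub>C f = c *\<^sub>C f + d *\<^sub>C f"
    "c *\<^sub>C d *\<^sub>C f = (c * d) *\<^sub>C f"
    by (transfer, simp add: scaleC_add_right scaleC_add_left)+
  show of_real: "complex_of_real r *\<^sub>C f = r *\<^sub>R f" for r and f :: "('a, 'b) hollip"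
    by (transfer, simp add: scaleC_of_real)
  show "norm f = 0 \<longleftrightarrow> f = 0"
  proof
    assume "norm f = 0"
    then show "f = 0"
    proof transfer
      fix f :: "'a \<Rightarrow> 'b"
      assume f: "holomorphic_lipschitz f" and 0: "lipschitz_const f + norm (f 0) = 0"
      have L: "(lipschitz_const f)-lipschitz_on (ball 0 1) f"
        using f by (rule holomorphic_lipschitz_lipschitz_const)
      with 0 have *: "lipschitz_const f = 0" "f 0 = 0"
        using lipschitz_on_nonneg[OF L] add_nonneg_eq_0_iff[of "lipschitz_const f" "norm (f 0)"]
        by simp_all
      show "f = (\<lambda>x. 0)"
      proof
        fix x show "f x = 0"
          using lipschitz_onD[OF L, of x 0] holomorphic_lipschitz_outside[OF f, of x] *
            by (cases "x \<in> ball 0 1") auto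
      qed
    qed
  next
    assume "f = 0"
    have "lipschitz_const (\<lambda>x :: 'a. 0 :: 'b) = 0"
    proof (rule antisym)
      have 0: "0-lipschitz_on (ball 0 1) (\<lambda>x :: 'a. 0 :: 'b)"
        by (rule lipschitz_onI) auto
      show "lipschitz_const (\<lambda>x :: 'a. 0 :: 'b) \<le> 0" by (rule lipschitz_const_le[OF 0])
      show "0 \<le> lipschitz_const (\<lambda>x :: 'a. 0 :: 'b)"
        using lipschitz_const[OF 0] lipschitz_on_nonneg by blast
    qed
    then show "norm f = 0" unfolding \<open>f = 0\<close> by transfer simp
  qed
  show "norm (f + g) \<le> norm f + norm g"
  proof transfer
    fix f g :: "'a \<Rightarrow> 'b"
    assume "holomorphic_lipschitz f"
      "holomorphic_lipschitz g"
    then have "lipschitz_const (\<lambda>x. f x + g x) \<le> lipschitz_const f + lipschitz_const g"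
      by (intro lipschitz_const_le lipschitz_on_add holomorphic_lipschitz_lipschitz_const)
    then show "lipschitz_const (\<lambda>x. f x + g x) + norm (f 0 + g 0)
      \<le> lipschitz_const f + norm (f 0) + (lipschitz_const g + norm (g 0))"
      using norm_triangle_ineq[of "f 0" "g 0"] by linarith
  qed
  show norm_C: "norm (c *\<^sub>C f) = cmod c * norm f" for c and f :: "('a, 'b) hollip"
  proof transfer
    fix c and f :: "'a \<Rightarrow> 'b"
    assume f: "holomorphic_lipschitz f"
    then have L: "(lipschitz_const f)-lipschitz_on (ball 0 1) f"
      by (rule holomorphic_lipschitz_lipschitz_const)
    note cL = lipschitz_on_scaleC[OF L, of c]
    have "lipschitz_const (\<lambda>x. c *\<^sub>C f x) = cmod c * lipschitz_const f"
    proof (rule antisym)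
      show le: "lipschitz_const (\<lambda>x. c *\<^sub>C f x) \<le> cmod c * lipschitz_const f"
        by (rule lipschitz_const_le[OF cL])
      show "cmod c * lipschitz_const f \<le> lipschitz_const (\<lambda>x. c *\<^sub>C f x)"
      proof (cases "c = 0")
        case True
        then show ?thesis using lipschitz_on_nonneg[OF lipschitz_const[OF cL]] by simp
      next
        case False
        have "lipschitz_const (\<lambda>x. inverse c *\<^sub>C c *\<^sub>C f x)
          \<le> cmod (inverse c) * lipschitz_const (\<lambda>x. c *\<^sub>C f x)"
          by (rule lipschitz_const_le[OF lipschitz_on_scaleC[OF lipschitz_const[OF cL]]])
        then show ?thesis using False by (simp add: norm_divide field_simps)
      qed
    qed
    then show "lipschitz_const (\<lambda>x. c *\<^sub>C f x) + norm (c *\<^sub>C f 0)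
        = cmod c * (lipschitz_const f + norm (f 0))"
      by (simp add: distrib_left)
  qed
  show "norm (r *\<^sub>R f) = \<bar>r\<bar> * norm f"
    using norm_C[of "complex_of_real r" f] by (simp add: of_real)
qed

end

lemma norm_hollip_apply_le: "norm (hollip_apply f x) \<le> norm f"
proof (cases "x \<in> ball 0 1")
  case True
  have "norm (hollip_apply f x - hollip_apply f 0) \<le> lipschitz_const (hollip_apply f) * norm (x - 0)"
    by (rule lipschitz_on_normD[OF hollip_lipschitz]) (use True in auto)
  also have "\<dots> \<le> lipschitz_const (hollip_apply f) * 1"
    by (rule mult_left_mono) (use True lipschitz_on_nonneg[OF hollip_lipschitz] in auto)
  finally show ?thesis
    using norm_triangle_sub[of "hollip_apply f x" "hollip_apply f 0"]
    by (simp add: norm_hollip.rep_eq)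
next
  case False
  then have "hollip_apply f x = 0"
    by (rule holomorphic_lipschitz_outside[OF holomorphic_lipschitz_hollip_apply])
  then show ?thesis by simp
qed

lemma lipschitz_const_hollip_le_norm: "lipschitz_const (hollip_apply f) \<le> norm f"
  by (simp add: norm_hollip.rep_eq)

text \<open>Completeness: the Lipschitz constant controls the derivatives uniformly on the ball.\<close>

lemma has_derivative_lipschitz_bound:
  assumes L: "C-lipschitz_on U f" and U: "open U" "x \<in> U" and D: "(f has_derivative D) (at x)"
  shows "norm (D h) \<le> C * norm h"
proof (rule field_le_epsilon)
  fix e :: real assume e: "e > 0"
  show "norm (D h) \<le> C * norm h + e"
  proof (cases "h = 0")
    case True
    then have "D h = 0" using has_derivative_linear[OF D] linear_0 by simp
    then show ?thesis using True e by simp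
  next
    case False
    define e' where "e' = e / norm h"
    have e': "e' > 0" using e False by (simp add: e'_def)
    obtain d where d: "d > 0"
      "\<And>y. norm (y - x) < d \<Longrightarrow> norm (f y - f x - D (y - x)) \<le> e' * norm (y - x)"
      using D e' unfolding has_derivative_at_alt by blast
    obtain d' where d': "d' > 0" "ball x d' \<subseteq> U"
      using U open_contains_ball by blast
    define t where "t = min d d' / (2 * norm h)"
    have t: "t > 0" "t * norm h < d" "t * norm h < d'"
      using d(1) d'(1) False by (auto simp: t_def)
    define y where "y = x + t *\<^sub>R h"
    have y: "y - x = t *\<^sub>R h" "norm (y - x) = t * norm h"
      using t by (simp_all add: y_def)
    have "dist x y < d'"
      unfolding dist_norm norm_minus_commute[of x y] y(2) by (rule t(3))
    then have "y \<in> U" using d' by auto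
    then have "norm (f y - f x) \<le> C * (t * norm h)"
      using lipschitz_on_normD[OF L _ U(2)] y by metis
    moreover have "D (y - x) = t *\<^sub>R D h"
      using has_derivative_linear[OF D] y by (simp add: linear_scale)
    then have "norm (f y - f x - t *\<^sub>R D h) \<le> e' * (t * norm h)"
      using d(2)[of y] t y by simp
    moreover have "norm (t *\<^sub>R D h) = t * norm (D h)" using t(1) by simp
    moreover have "norm (t *\<^sub>R D h) \<le> norm (f y - f x) + norm (f y - f x - t *\<^sub>R D h)"
      using norm_triangle_ineq4[of "f y - f x" "f y - f x - t *\<^sub>R D h"] by simp
    ultimately have "t * norm (D h) \<le> C * (t * norm h) + e' * (t * norm h)" by linarith
    also have "\<dots> = t * (C * norm h + e)"
      using False by (simp add: e'_def algebra_simps)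
    finally show ?thesis using t(1) by simp
  qed
qed

instance hollip :: (complex_normed_vector, complex_banach) complex_banach
proof
  fix X :: "nat \<Rightarrow> ('a, 'b) hollip"
  assume X: "Cauchy X"
  let ?B = "ball (0 :: 'a) 1"
  have "\<forall>n. \<forall>x\<in>?B. \<exists>D. bounded_clinear D \<and> (hollip_apply (X n) has_derivative D) (at x)"
    using holomorphic_lipschitz_hollip_apply
    unfolding holomorphic_lipschitz_def holomorphic_map_on_def by blast
  then obtain D where D: "\<And>n x. x \<in> ?B \<Longrightarrow> bounded_clinear (D n x)"
    "\<And>n x. x \<in> ?B \<Longrightarrow> (hollip_apply (X n) has_derivative D n x) (at x)"
    by metis
  define E where "E n x = Clinfun (D n x)" for n x
  have E: "clinfun_apply (E n x) = D n x" if "x \<in> ?B" for n x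
    using D(1)[OF that] by (simp add: E_def Clinfun_inverse)
  have le: "norm (E m x - E n x) \<le> norm (X m - X n)" if x: "x \<in> ?B" for m n x
  proof (rule norm_clinfun_bound)
    fix h
    have "((\<lambda>y. hollip_apply (X m) y - hollip_apply (X n) y) has_derivative
        (\<lambda>h. D m x h - D n x h)) (at x)"
      by (intro has_derivative_diff D(2) x)
    then have "(hollip_apply (X m - X n) has_derivative (\<lambda>h. D m x h - D n x h)) (at x)"
      by (simp add: minus_hollip.rep_eq)
    from has_derivative_lipschitz_bound[OF hollip_lipschitz open_ball x this, of h]
    have "norm (D m x h - D n x h) \<le> lipschitz_const (hollip_apply (X m - X n)) * norm h" .
    also have "\<dots> \<le> norm (X m - X n) * norm h"
      by (intro mult_right_mono lipschitz_const_hollip_le_norm) simp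
    finally show "norm (clinfun_apply (E m x - E n x) h) \<le> norm (X m - X n) * norm h"
      by (simp add: minus_clinfun.rep_eq E[OF x])
  qed simp
  have N: "\<exists>N. \<forall>m\<ge>N. \<forall>n\<ge>N. norm (X m - X n) \<le> e" if "e > 0" for e
    using CauchyD[OF X that] by (meson less_imp_le)
  have "\<exists>G. (\<lambda>n. E n x) \<longlonglongrightarrow> G" if x: "x \<in> ?B" for x
  proof -
    have "Cauchy (\<lambda>n. E n x)"
      using CauchyD[OF X] le[OF x] by (intro CauchyI) (meson le_less_trans)
    then show ?thesis using Cauchy_convergent convergent_def by blast
  qed
  then obtain G where G: "\<And>x. x \<in> ?B \<Longrightarrow> (\<lambda>n. E n x) \<longlonglongrightarrow> G x" by metis
  have unif: "norm (E n x - G x) \<le> e"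
    if N: "\<forall>m\<ge>N. \<forall>n\<ge>N. norm (X m - X n) \<le> e" "n \<ge> N" and x: "x \<in> ?B" for N n e x
  proof (rule tendsto_upperbound)
    show "(\<lambda>m. norm (E n x - E m x)) \<longlonglongrightarrow> norm (E n x - G x)"
      by (intro tendsto_intros G x)
    show "\<forall>\<^sub>F m in sequentially. norm (E n x - E m x) \<le> e"
      unfolding eventually_sequentially using le[OF x] N by (meson order_trans)
  qed simp
  have Cauchy_at: "Cauchy (\<lambda>n. hollip_apply (X n) x)" for x
  proof (rule CauchyI)
    fix e :: real assume "0 < e"
    from CauchyD[OF X this] obtain M where M: "\<And>m n. m \<ge> M \<Longrightarrow> n \<ge> M \<Longrightarrow> norm (X m - X n) < e"
      by blast
    have "norm (hollip_apply (X m) x - hollip_apply (X n) x) < e" if "m \<ge> M" "n \<ge> M" for m n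
      using norm_hollip_apply_le[of "X m - X n" x] M[OF that] by (simp add: minus_hollip.rep_eq)
    then show "\<exists>M. \<forall>m\<ge>M. \<forall>n\<ge>M. norm (hollip_apply (X m) x - hollip_apply (X n) x) < e"
      by blast
  qed
  then obtain l where l: "(\<lambda>n. hollip_apply (X n) 0) \<longlonglongrightarrow> l"
    using Cauchy_convergent convergent_def by blast
  have "\<exists>g. \<forall>x\<in>?B. (\<lambda>n. hollip_apply (X n) x) \<longlonglongrightarrow> g x \<and>
      (g has_derivative clinfun_apply (G x)) (at x within ?B)"
  proof (rule has_derivative_sequence[where f = "\<lambda>n. hollip_apply (X n)" and f' = D and l = l])
    fix e :: real assume "e > 0"
    with N obtain N where N: "\<forall>m\<ge>N. \<forall>n\<ge>N. norm (X m - X n) \<le> e" by blast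
    have "norm (D n x h - clinfun_apply (G x) h) \<le> e * norm h"
      if "n \<ge> N" "x \<in> ?B" for n x h
    proof -
      have "norm (clinfun_apply (E n x - G x) h) \<le> norm (E n x - G x) * norm h"
        by (rule norm_clinfun)
      also have "\<dots> \<le> e * norm h"
        by (intro mult_right_mono unif[OF N that]) simp
      finally show ?thesis using that by (simp add: minus_clinfun.rep_eq E)
    qed
    then show "\<forall>\<^sub>F n in sequentially. \<forall>x\<in>?B. \<forall>h.
        norm (D n x h - clinfun_apply (G x) h) \<le> e * norm h"
      unfolding eventually_sequentially by blast
  next
    fix n x assume "x \<in> ?B"
    from D(2)[OF this] show "(hollip_apply (X n) has_derivative D n x) (at x within ?B)"
      by (rule has_derivative_at_withinI)
  next
    show "(\<lambda>n. hollip_apply (X n) 0) \<longlonglongrightarrow> l" by (rule l)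
  qed simp_all
  then obtain g where g: "\<And>x. x \<in> ?B \<Longrightarrow> (\<lambda>n. hollip_apply (X n) x) \<longlonglongrightarrow> g x"
    "\<And>x. x \<in> ?B \<Longrightarrow> (g has_derivative clinfun_apply (G x)) (at x within ?B)"
    by blast
  define F where "F x = (if x \<in> ?B then g x else 0)" for x
  have F: "(\<lambda>n. hollip_apply (X n) x) \<longlonglongrightarrow> F x" for x
  proof (cases "x \<in> ?B")
    case True
    with g(1)[OF this] show ?thesis by (simp add: F_def)
  next
    case False
    then have "hollip_apply (X n) x = 0" for n
      by (rule holomorphic_lipschitz_outside[OF holomorphic_lipschitz_hollip_apply])
    with False show ?thesis by (simp add: F_def)
  qed
  have lip: "e-lipschitz_on ?B (\<lambda>x. hollip_apply (X n) x - F x)"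
    if N: "\<forall>m\<ge>N. \<forall>n\<ge>N. norm (X m - X n) \<le> e" "n \<ge> N" for N n e
  proof (rule lipschitz_onI)
    show "0 \<le> e" using N(1)[rule_format, OF N(2) N(2)] by simp
    fix x y assume xy: "x \<in> ?B" "y \<in> ?B"
    show "dist (hollip_apply (X n) x - F x) (hollip_apply (X n) y - F y) \<le> e * dist x y"
    proof (rule tendsto_upperbound)
      show "(\<lambda>m. dist (hollip_apply (X n) x - hollip_apply (X m) x)
          (hollip_apply (X n) y - hollip_apply (X m) y))
        \<longlonglongrightarrow> dist (hollip_apply (X n) x - F x) (hollip_apply (X n) y - F y)"
        by (intro tendsto_dist tendsto_diff tendsto_const F)
      have "dist (hollip_apply (X n) x - hollip_apply (X m) x)
          (hollip_apply (X n) y - hollip_apply (X m) y) \<le> e * dist x y" if "m \<ge> N" for m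
      proof -
        have "dist (hollip_apply (X n - X m) x) (hollip_apply (X n - X m) y)
            \<le> lipschitz_const (hollip_apply (X n - X m)) * dist x y"
          by (rule lipschitz_onD[OF hollip_lipschitz xy])
        also have "\<dots> \<le> e * dist x y"
          using order_trans[OF lipschitz_const_hollip_le_norm N(1)[rule_format, OF N(2) that]]
          by (rule mult_right_mono) simp
        finally show ?thesis by (simp add: minus_hollip.rep_eq)
      qed
      then show "\<forall>\<^sub>F m in sequentially. dist (hollip_apply (X n) x - hollip_apply (X m) x)
          (hollip_apply (X n) y - hollip_apply (X m) y) \<le> e * dist x y"
        unfolding eventually_sequentially by blast
    qed simp
  qed
  have "holomorphic_lipschitz F"
    unfolding holomorphic_lipschitz_def
  proof (intro conjI allI impI)
    from N[of 1] obtain N where "\<forall>m\<ge>N. \<forall>n\<ge>N. norm (X m - X n) \<le> 1" by auto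
    from lipschitz_on_diff[OF hollip_lipschitz[of "X N"] lip[OF this order_refl]]
    show "\<exists>C. C-lipschitz_on ?B F" by auto
    show "holomorphic_map_on F ?B"
      unfolding holomorphic_map_on_def
    proof (intro ballI exI conjI)
      fix x assume x: "x \<in> ?B"
      show "bounded_clinear (clinfun_apply (G x))"
        by (rule bounded_clinear_clinfun_apply)
      have "(g has_derivative clinfun_apply (G x)) (at x)"
        using g(2)[OF x] at_within_open[OF x open_ball] by simp
      then show "(F has_derivative clinfun_apply (G x)) (at x)"
        by (rule has_derivative_transform_within_open[OF _ open_ball x]) (simp add: F_def)
    qed
  qed (simp add: F_def)
  then have HF: "hollip_apply (Hollip F) = F" by (simp add: Hollip_inverse)
  have "X \<longlonglongrightarrow> Hollip F"
  proof (rule metric_LIMSEQ_I)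
    fix e :: real assume e: "e > 0"
    with N[of "e / 3"] obtain N where N: "\<forall>m\<ge>N. \<forall>n\<ge>N. norm (X m - X n) \<le> e / 3" by auto
    obtain M where M: "\<And>n. n \<ge> M \<Longrightarrow> norm (hollip_apply (X n) 0 - F 0) < e / 3"
      using LIMSEQ_D[OF F, of "e / 3"] e by auto
    have "dist (X n) (Hollip F) < e" if n: "n \<ge> max M N" for n
    proof -
      have "lipschitz_const (\<lambda>x. hollip_apply (X n) x - F x) \<le> e / 3"
        using lipschitz_const_le[OF lip[OF N]] n by simp
      moreover have "dist (X n) (Hollip F) = lipschitz_const (\<lambda>x. hollip_apply (X n) x - F x)
          + norm (hollip_apply (X n) 0 - F 0)"
        by (simp add: dist_norm norm_hollip.rep_eq minus_hollip.rep_eq HF)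
      ultimately show ?thesis using M[of n] n e by simp
    qed
    then show "\<exists>N. \<forall>n\<ge>N. dist (X n) (Hollip F) < e" by blast
  qed
  then show "convergent X" by (rule convergentI)
qed


section \<open>The predual\<close>

lemma closure_csubspace:
  assumes S: "complex_vector.subspace S"
  shows "complex_vector.subspace (closure S)"
proof (rule complex_vector.subspaceI)
  show "0 \<in> closure S"
    using complex_vector.subspace_0[OF S] closure_subset by blast
next
  fix x y assume x: "x \<in> closure S" and y: "y \<in> closure S"
  from x obtain u where u: "\<And>n. u n \<in> S" "u \<longlonglongrightarrow> x"
    by (auto simp: closure_sequential)
  from y obtain v where v: "\<And>n. v n \<in> S" "v \<longlonglongrightarrow> y"
    by (auto simp: closure_sequential)
  have "(\<lambda>n. u n + v n) \<longlonglongrightarrow> x + y" by (rule tendsto_add[OF u(2) v(2)])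
  moreover have "u n + v n \<in> S" for n by (rule complex_vector.subspace_add[OF S u(1) v(1)])
  ultimately show "x + y \<in> closure S"
    unfolding closure_sequential by (intro exI[of _ "\<lambda>n. u n + v n"]) simp
next
  fix c x assume "x \<in> closure S"
  then obtain u where u: "\<And>n. u n \<in> S" "u \<longlonglongrightarrow> x"
    by (auto simp: closure_sequential)
  have "(\<lambda>n. c *\<^sub>C u n) \<longlonglongrightarrow> c *\<^sub>C x"
    by (rule bounded_linear.tendsto[OF scaleC_right_bounded_linear u(2)])
  moreover have "c *\<^sub>C u n \<in> S" for n by (rule complex_vector.subspace_scale[OF S u(1)])
  ultimately show "c *\<^sub>C x \<in> closure S"
    unfolding closure_sequential by (intro exI[of _ "\<lambda>n. c *\<^sub>C u n"]) simp
qed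

text \<open>Outside the unit ball this functional is zero.\<close>

lift_definition eval_functional ::
    "'a::complex_normed_vector \<Rightarrow> ('a, complex) hollip \<Rightarrow>\<^sub>C\<^sub>L complex"
  is "\<lambda>x f. hollip_apply f x"
  unfolding bounded_clinear_def
  by (auto intro!: bounded_linear_intro[where K = 1]
      simp: plus_hollip.rep_eq scaleR_hollip.rep_eq scaleC_hollip.rep_eq norm_hollip_apply_le)

definition predual_set :: "(('a::complex_normed_vector, complex) hollip \<Rightarrow>\<^sub>C\<^sub>L complex) set"
  where "predual_set = closure (cspan (eval_functional ` ball 0 1))"

lemma csubspace_predual_set: "complex_vector.subspace predual_set"
  unfolding predual_set_def by (intro closure_csubspace complex_vector.subspace_span)

lemma eval_functional_in_predual_set: "x \<in> ball 0 1 \<Longrightarrow> eval_functional x \<in> predual_set"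
  unfolding predual_set_def
  by (intro subsetD[OF closure_subset] complex_vector.span_base imageI)

typedef (overloaded) 'a predual =
  "predual_set :: (('a::complex_normed_vector, complex) hollip \<Rightarrow>\<^sub>C\<^sub>L complex) set"
  morphisms predual_functional Predual
  using complex_vector.subspace_0[OF csubspace_predual_set] by blast

setup_lifting type_definition_predual

instantiation predual :: (complex_normed_vector) complex_normed_vector
begin

lift_definition norm_predual :: "'a predual \<Rightarrow> real" is norm .

lift_definition zero_predual :: "'a predual" is 0
  by (rule complex_vector.subspace_0[OF csubspace_predual_set])

lift_definition plus_predual :: "'a predual \<Rightarrow> 'a predual \<Rightarrow> 'a predual" is "(+)"
  by (rule complex_vector.subspace_add[OF csubspace_predual_set])

lift_definition minus_predual :: "'a predual \<Rightarrow> 'a predual \<Rightarrow> 'a predual" is "(-)"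
  by (rule complex_vector.subspace_diff[OF csubspace_predual_set])

lift_definition uminus_predual :: "'a predual \<Rightarrow> 'a predual" is uminus
  by (rule complex_vector.subspace_neg[OF csubspace_predual_set])

lift_definition scaleC_predual :: "complex \<Rightarrow> 'a predual \<Rightarrow> 'a predual" is scaleC
  by (rule complex_vector.subspace_scale[OF csubspace_predual_set])

lift_definition scaleR_predual :: "real \<Rightarrow> 'a predual \<Rightarrow> 'a predual" is scaleR
  unfolding scaleC_of_real[symmetric]
  by (rule complex_vector.subspace_scale[OF csubspace_predual_set])

definition dist_predual :: "'a predual \<Rightarrow> 'a predual \<Rightarrow> real"
  where "dist_predual x y = norm (x - y)"

definition sgn_predual :: "'a predual \<Rightarrow> 'a predual"
  where "sgn_predual x = inverse (norm x) *\<^sub>R x"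

definition uniformity_predual :: "('a predual \<times> 'a predual) filter"
  where "uniformity_predual = (INF e\<in>{0<..}. principal {(x, y). dist x y < e})"

definition open_predual :: "'a predual set \<Rightarrow> bool"
  where "open_predual S = (\<forall>x\<in>S. \<forall>\<^sub>F (x', y) in uniformity. x' = x \<longrightarrow> y \<in> S)"

instance
proof
  fix x y z :: "'a predual" and r s :: real and c d :: complex and S :: "'a predual set"
  show "dist x y = norm (x - y)" by (rule dist_predual_def)
  show "sgn x = inverse (norm x) *\<^sub>R x" by (rule sgn_predual_def)
  show "uniformity = (INF e\<in>{0<..}. principal {(x, y :: 'a predual). dist x y < e})"
    by (rule uniformity_predual_def)
  show "open S = (\<forall>x\<in>S. \<forall>\<^sub>F (x', y) in uniformity. x' = x \<longrightarrow> y \<in> S)"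
    by (rule open_predual_def)
  show "x + y + z = x + (y + z)" "x + y = y + x" "0 + x = x" "- x + x = 0" "x - y = x + - y"
    by (transfer, simp add: algebra_simps)+
  show "r *\<^sub>R (x + y) = r *\<^sub>R x + r *\<^sub>R y" "(r + s) *\<^sub>R x = r *\<^sub>R x + s *\<^sub>R x"
    "r *\<^sub>R s *\<^sub>R x = (r * s) *\<^sub>R x" "1 *\<^sub>R x = x"
    by (transfer, simp add: algebra_simps)+
  show "c *\<^sub>C (x + y) = c *\<^sub>C x + c *\<^sub>C y" "(c + d) *\<^sub>C x = c *\<^sub>C x + d *\<^sub>C x"
    "c *\<^sub>C d *\<^sub>C x = (c * d) *\<^sub>C x" "complex_of_real r *\<^sub>C x = r *\<^sub>R x"
    by (transfer, simp add: scaleC_add_right scaleC_add_left scaleC_of_real)+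
  show "norm x = 0 \<longleftrightarrow> x = 0" "norm (r *\<^sub>R x) = \<bar>r\<bar> * norm x" "norm (c *\<^sub>C x) = cmod c * norm x"
    by (transfer, simp)+
  show "norm (x + y) \<le> norm x + norm y"
    by (transfer, rule norm_triangle_ineq)
qed

end

instance predual :: (complex_normed_vector) complex_banach
proof
  fix X :: "nat \<Rightarrow> 'a predual"
  assume X: "Cauchy X"
  have "Cauchy (\<lambda>n. predual_functional (X n))"
    using X by (simp add: Cauchy_def dist_norm norm_predual.rep_eq minus_predual.rep_eq)
  then obtain \<phi> where \<phi>: "(\<lambda>n. predual_functional (X n)) \<longlonglongrightarrow> \<phi>"
    using Cauchy_convergent convergent_def by blast
  have "closed (predual_set :: (('a, complex) hollip \<Rightarrow>\<^sub>C\<^sub>L complex) set)"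
    by (simp add: predual_set_def)
  then have "\<phi> \<in> predual_set"
    using closed_sequentially[OF _ _ \<phi>] predual_functional by blast
  then have "predual_functional (Predual \<phi>) = \<phi>"
    by (rule Predual_inverse)
  then have "X \<longlonglongrightarrow> Predual \<phi>"
    using \<phi> by (simp add: LIMSEQ_iff norm_predual.rep_eq minus_predual.rep_eq)
  then show "convergent X" by (rule convergentI)
qed

definition delta :: "'a::complex_normed_vector \<Rightarrow> 'a predual"
  where "delta x = Predual (eval_functional x)"

lemma predual_functional_delta:
  "x \<in> ball 0 1 \<Longrightarrow> predual_functional (delta x) = eval_functional x"
  by (simp add: delta_def Predual_inverse eval_functional_in_predual_set)

text \<open>\<open>T\<^sub>f\<close>, the operator on the predual with \<open>f = T\<^sub>f \<circ> \<delta>\<close> on the ball.\<close>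

definition linearization ::
    "('a::complex_banach, 'b::complex_banach) hollip \<Rightarrow> 'a predual \<Rightarrow>\<^sub>C\<^sub>L 'b"
  where "linearization f =
    (THE T. \<forall>x\<in>ball 0 1. hollip_apply f x = clinfun_apply T (delta x))"


section \<open>Topologies on the space of scalar maps\<close>

definition dual_weak_star_topology :: "('a::complex_normed_vector \<Rightarrow>\<^sub>C\<^sub>L complex) topology"
  where "dual_weak_star_topology =
    pullback_topology UNIV clinfun_apply (product_topology (\<lambda>_. euclidean) UNIV)"

text \<open>The weak* topology of the dual of the predual, transported along \<open>f \<mapsto> T\<^sub>f\<close>.\<close>

definition weak_star_topology :: "('a::complex_banach, complex) hollip topology"
  where "weak_star_topology = pullback_topology UNIV linearization dual_weak_star_topology"

definition pointwise_topology :: "('a::complex_normed_vector, complex) hollip topology"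
  where "pointwise_topology =
    pullback_topology UNIV (\<lambda>f. restrict (hollip_apply f) (ball 0 1))
      (product_topology (\<lambda>_. euclidean) (ball 0 1))"

definition compact_convergence_topology ::
    "('a::complex_normed_vector, complex) hollip topology"
  where "compact_convergence_topology = topology (\<lambda>U.
    \<forall>f\<in>U. \<exists>K e. compact K \<and> K \<subseteq> ball 0 1 \<and> e > 0 \<and>
      {g. \<forall>x\<in>K. dist (hollip_apply g x) (hollip_apply f x) < e} \<subseteq> U)"

lemma openin_compact_convergence_topology:
  fixes U :: "('a::complex_normed_vector, complex) hollip set"
  shows "openin compact_convergence_topology U \<longleftrightarrow>
    (\<forall>f\<in>U. \<exists>K e. compact K \<and> K \<subseteq> ball 0 1 \<and> e > 0 \<and>
      {g. \<forall>x\<in>K. dist (hollip_apply g x) (hollip_apply f x) < e} \<subseteq> U)"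
proof -
  define N where "N f K e = {g. \<forall>x\<in>K. dist (hollip_apply g x) (hollip_apply f x) < e}"
    for f :: "('a, complex) hollip" and K e
  define P where "P U \<longleftrightarrow>
      (\<forall>f\<in>U. \<exists>K e. compact K \<and> K \<subseteq> ball 0 1 \<and> e > 0 \<and> N f K e \<subseteq> U)" for U
  have Int: "P (S \<inter> T)" if S': "P S" and T': "P T" for S T
    unfolding P_def
  proof
    fix f assume f: "f \<in> S \<inter> T"
    from S' f obtain K e where S: "compact K" "K \<subseteq> ball 0 1" "e > 0" "N f K e \<subseteq> S"
      unfolding P_def by (metis IntD1)
    from T' f obtain L d where T: "compact L" "L \<subseteq> ball 0 1" "d > 0" "N f L d \<subseteq> T"
      unfolding P_def by (metis IntD2)
    have "N f (K \<union> L) (min e d) \<subseteq> N f K e \<inter> N f L d"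
      unfolding N_def by auto
    then have "N f (K \<union> L) (min e d) \<subseteq> S \<inter> T"
      using S(4) T(4) by (meson Int_mono order_trans)
    moreover have "compact (K \<union> L)" using S(1) T(1) by (rule compact_Un)
    moreover have "K \<union> L \<subseteq> ball 0 1" using S(2) T(2) by (rule Un_least)
    moreover have "min e d > 0" using S(3) T(3) by simp
    ultimately show "\<exists>K e. compact K \<and> K \<subseteq> ball 0 1 \<and> e > 0 \<and> N f K e \<subseteq> S \<inter> T"
      by (intro exI[of _ "K \<union> L"] exI[of _ "min e d"] conjI)
  qed
  have Un: "P (\<Union>\<K>)" if "\<forall>U\<in>\<K>. P U" for \<K>
    using that unfolding P_def by (meson UnionE Union_upper order_trans)
  have P: "istopology P"
    unfolding istopology_def by (intro conjI allI impI Int Un)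
  have "compact_convergence_topology = topology P"
    unfolding compact_convergence_topology_def P_def N_def ..
  then have "openin compact_convergence_topology U \<longleftrightarrow> P U"
    using topology_inverse'[OF P] by metis
  then show ?thesis
    unfolding P_def N_def .
qed

end

theory Submission
  imports Defs "HOL-Complex_Analysis.Cauchy_Integral_Formula"
begin

text \<open>
  Everything rests on two facts about the evaluation map \<open>\<delta>\<close>. It is holomorphic as a map of the ball
  into the normed space \<open>predual\<close>: the error of the first-order expansion of \<open>f\<close> at \<open>x\<close> is, for small \<open>h\<close>, at most
  \<open>8 \<parallel>f\<parallel> \<parallel>h\<parallel>\<^sup>2 / (1 - \<parallel>x\<parallel>)\<^sup>2\<close> by the Cauchy estimates on the complex line through \<open>x\<close> in the
  direction \<open>h\<close> (\<open>hollip_first_order_remainder\<close>), and this bound is uniform over the unit ball of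
  the space of scalar maps, which is what differentiability in the dual norm asks for. It is also
  1-Lipschitz. So \<open>T \<circ> \<delta>\<close> is a holomorphic Lipschitz map for every bounded operator \<open>T\<close>, and \<open>f \<mapsto> T\<^sub>f\<close>
  is onto.

  In the other direction, a map \<open>f\<close> into \<open>Y\<close> sends a functional \<open>\<phi>\<close> on scalar maps to the element
  \<open>l \<mapsto> \<phi> (l \<circ> f)\<close> of the bidual of \<open>Y\<close>. For \<open>\<phi> = \<delta> x\<close> this is the vector \<open>f x\<close>; the functionals for
  which it comes from a vector of \<open>Y\<close> form a closed subspace, as \<open>Y\<close> is complete, so they contain the
  whole predual (\<open>ex_vector_representing_functional\<close>). The vector is \<open>T\<^sub>f \<phi>\<close>, and
  \<open>\<parallel>T\<^sub>f \<phi>\<parallel> \<le> \<parallel>\<phi>\<parallel> \<parallel>f\<parallel>\<close> because norms in \<open>Y\<close> are attained on functionals of norm at most one. This is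
  the first use of the Hahn--Banach theorem, proved here through graphs and Zorn's lemma
  (\<open>sublinear_dominated_extension\<close>).

  On a norm-bounded set of scalar maps the members are Lipschitz with a common constant, so closeness
  on a fine finite net of a compact set gives closeness on all of it: \<open>\<tau>\<^sub>0\<close> is \<open>\<tau>\<^sub>p\<close>. An element of the
  predual is a limit, uniform on bounded sets, of combinations of evaluations and therefore
  \<open>\<tau>\<^sub>p\<close>-continuous there, so \<open>w\<^sup>*\<close> is \<open>\<tau>\<^sub>p\<close> too.

  Finally, let \<open>\<phi>\<close> be \<open>\<tau>\<^sub>p\<close>-continuous on the ball of radius \<open>r\<close>. Continuity at 0 gives finitely many
  points such that \<open>\<phi>\<close> has norm at most \<open>\<epsilon>\<close> on the subspace of maps vanishing at these points. By
  Hahn--Banach that restriction extends to some \<open>\<psi>\<close> with \<open>\<parallel>\<psi>\<parallel> \<le> \<epsilon>\<close>, and \<open>\<phi> - \<psi>\<close> vanishes on the common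
  kernel of finitely many evaluations, hence is a combination of them. So \<open>\<phi>\<close> is within \<open>\<epsilon>\<close> of the
  span (\<open>in_predual_set_if_pointwise_continuous\<close>).
\<close>

section \<open>Bounded complex-linear operators\<close>

lemma clinfun_apply_add: "clinfun_apply T (x + y) = clinfun_apply T x + clinfun_apply T y"
  using bounded_clinear_clinfun_apply[of T]
  by (simp add: bounded_clinear_def linear_add[OF bounded_linear.linear])

lemma clinfun_apply_diff: "clinfun_apply T (x - y) = clinfun_apply T x - clinfun_apply T y"
  using bounded_clinear_clinfun_apply[of T]
  by (simp add: bounded_clinear_def linear_diff[OF bounded_linear.linear])

lemma clinfun_apply_scaleC: "clinfun_apply T (c *\<^sub>C x) = c *\<^sub>C clinfun_apply T x"
  using bounded_clinear_clinfun_apply[of T] by (simp add: bounded_clinear_def)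

lemma clinfun_apply_zero: "clinfun_apply T 0 = 0"
  using clinfun_apply_diff[of T 0 0] by simp

lemma bounded_linear_clinfun_apply: "bounded_linear (clinfun_apply T)"
  using bounded_clinear_clinfun_apply[of T] by (simp add: bounded_clinear_def)

lemma continuous_on_clinfun_apply: "continuous_on S (clinfun_apply T)"
  by (rule linear_continuous_on[OF bounded_linear_clinfun_apply])

lemma bounded_clinearI:
  assumes "\<And>x y. f (x + y) = f x + f y" "\<And>c x. f (c *\<^sub>C x) = c *\<^sub>C f x"
    "\<And>x. norm (f x) \<le> K * norm x"
  shows "bounded_clinear f"
  unfolding bounded_clinear_def
proof (intro conjI allI)
  have "f (r *\<^sub>R x) = r *\<^sub>R f x" for r x using assms(2)[of "of_real r" x] by (simp add: scaleC_of_real)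
  then show "bounded_linear f"
    using assms by (intro bounded_linear_intro[where K = K]) (simp_all add: mult.commute)
qed (rule assms(2))

lemma bounded_clinear_compose:
  "bounded_clinear g \<Longrightarrow> bounded_clinear f \<Longrightarrow> bounded_clinear (\<lambda>x. g (f x))"
  by (simp add: bounded_clinear_def bounded_linear_compose)

lemma csubspace_imp_subspace: "complex_vector.subspace S \<Longrightarrow> subspace S"
  unfolding subspace_def complex_vector.subspace_def by (metis scaleC_of_real)

section \<open>The Hahn--Banach theorem for complex normed spaces\<close>

text \<open>Partial functionals are handled as graphs. A subspace of the product whose points \<open>(x, a)\<close> satisfy
  \<open>a \<le> p x\<close> is automatically single-valued, since \<open>(0, a)\<close> and \<open>(0, -a)\<close> force \<open>a = 0\<close>; so Zorn's
  lemma applies to plain subspaces ordered by inclusion, and a maximal one is the graph of the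
  extension.\<close>

lemma sublinear_dominated_extension:
  fixes p :: "'a::real_vector \<Rightarrow> real" and G :: "('a \<times> real) set"
  assumes p_add: "\<And>x y. p (x + y) \<le> p x + p y"
    and p_scale: "\<And>t x. t > 0 \<Longrightarrow> p (t *\<^sub>R x) = t * p x"
    and G: "subspace G" and G_le: "\<And>x a. (x, a) \<in> G \<Longrightarrow> a \<le> p x"
  shows "\<exists>U. linear U \<and> (\<forall>(x, a)\<in>G. U x = a) \<and> (\<forall>x. U x \<le> p x)"
proof -
  define \<A> where "\<A> = {H. subspace H \<and> G \<subseteq> H \<and> (\<forall>(x, a)\<in>H. a \<le> p x)}"
  have "\<exists>M\<in>\<A>. \<forall>X\<in>\<A>. M \<subseteq> X \<longrightarrow> X = M"
  proof (rule subset_Zorn_nonempty)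
    show "\<A> \<noteq> {}" using G G_le by (auto simp: \<A>_def)
    fix \<C> assume ne: "\<C> \<noteq> {}" and ch: "subset.chain \<A> \<C>"
    have mem: "H \<in> \<A>" if "H \<in> \<C>" for H using ch that by (auto simp: subset.chain_def)
    have lin: "H \<subseteq> K \<or> K \<subseteq> H" if "H \<in> \<C>" "K \<in> \<C>" for H K
      using ch that by (auto simp: subset.chain_def)
    have "subspace (\<Union>\<C>)"
    proof (rule subspaceI)
      show "0 \<in> \<Union>\<C>" using ne mem by (fastforce simp: \<A>_def subspace_0)
    next
      fix u v assume "u \<in> \<Union>\<C>" "v \<in> \<Union>\<C>"
      then obtain H K where "H \<in> \<C>" "u \<in> H" "K \<in> \<C>" "v \<in> K" by blast
      then obtain L where "L \<in> \<C>" "u \<in> L" "v \<in> L" using lin by blast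
      then show "u + v \<in> \<Union>\<C>" using mem[of L] by (auto simp: \<A>_def intro: subspace_add)
    next
      fix c u assume "u \<in> \<Union>\<C>"
      then obtain H where "H \<in> \<C>" "u \<in> H" by blast
      then show "c *\<^sub>R u \<in> \<Union>\<C>" using mem[of H] by (auto simp: \<A>_def intro: subspace_scale)
    qed
    moreover have "G \<subseteq> \<Union>\<C>" using ne mem by (fastforce simp: \<A>_def)
    moreover have "\<forall>(x, a)\<in>\<Union>\<C>. a \<le> p x" using mem by (fastforce simp: \<A>_def)
    ultimately show "\<Union>\<C> \<in> \<A>" by (simp add: \<A>_def)
  qed
  then obtain M where "M \<in> \<A>" and maximal: "\<And>X. X \<in> \<A> \<Longrightarrow> M \<subseteq> X \<Longrightarrow> X = M" by blast
  then have M: "subspace M" "G \<subseteq> M" and M_le: "\<And>x a. (x, a) \<in> M \<Longrightarrow> a \<le> p x"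
    by (auto simp: \<A>_def)
  have p0: "p 0 = 0" using p_scale[of 2 0] by simp
  have unique: "a = b" if "(x, a) \<in> M" "(x, b) \<in> M" for x a b
    using M_le[of 0 "a - b"] M_le[of 0 "b - a"] p0
      subspace_diff[OF M(1) that] subspace_diff[OF M(1) that(2,1)] by simp
  have total: "\<exists>a. (x, a) \<in> M" for x
  proof -
    have gap: "a - p (y - x) \<le> p (z + x) - b" if "(y, a) \<in> M" "(z, b) \<in> M" for y z a b
    proof -
      have "(y + z, a + b) \<in> M" using subspace_add[OF M(1) that] by simp
      from M_le[OF this] have "a + b \<le> p ((y - x) + (z + x))" by simp
      also have "\<dots> \<le> p (y - x) + p (z + x)" by (rule p_add)
      finally show ?thesis by simp
    qed
    have M0: "(0, 0) \<in> M" using subspace_0[OF M(1)] by (simp add: zero_prod_def)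
    \<comment> \<open>By \<open>gap\<close>, a number lies above all the left sides and below all the right sides; it is the value at \<open>x\<close>.\<close>
    define c where "c = (SUP (y, a)\<in>M. a - p (y - x))"
    have bdd: "bdd_above ((\<lambda>(y, a). a - p (y - x)) ` M)"
      using gap[OF _ M0] by (intro bdd_aboveI[of _ "p x"]) auto
    have lower: "a - c \<le> p (y - x)" if "(y, a) \<in> M" for y a
      using cSUP_upper[OF that bdd] by (simp add: c_def)
    have upper: "b + c \<le> p (z + x)" if "(z, b) \<in> M" for z b
    proof -
      have "c \<le> p (z + x) - b"
        unfolding c_def by (rule cSUP_least) (use M0 gap[OF _ that] in auto)
      then show ?thesis by simp
    qed
    have bound: "a + t * c \<le> p (y + t *\<^sub>R x)" if ya: "(y, a) \<in> M" for y a t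
    proof (cases t "0::real" rule: linorder_cases)
      case equal
      then show ?thesis using M_le[OF ya] by simp
    next
      case greater
      have "((1 / t) *\<^sub>R y, a / t) \<in> M" using subspace_scale[OF M(1) ya, of "1 / t"] by simp
      from upper[OF this] have "t * (a / t + c) \<le> t * p ((1 / t) *\<^sub>R y + x)"
        using greater by (intro mult_left_mono) auto
      also have "\<dots> = p (y + t *\<^sub>R x)"
        using p_scale[OF greater] greater by (simp flip: p_scale add: scaleR_add_right)
      finally show ?thesis using greater by (simp add: distrib_left)
    next
      case less
      define s where "s = - t"
      have s: "s > 0" using less by (simp add: s_def)
      have "((1 / s) *\<^sub>R y, a / s) \<in> M" using subspace_scale[OF M(1) ya, of "1 / s"] by simp
      from lower[OF this] have "s * (a / s - c) \<le> s * p ((1 / s) *\<^sub>R y - x)"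
        using s by (intro mult_left_mono) auto
      also have "\<dots> = p (y - s *\<^sub>R x)"
        using s by (simp flip: p_scale add: scaleR_diff_right)
      finally show ?thesis using s by (simp add: right_diff_distrib s_def)
    qed
    define M' where "M' = span (insert (x, c) M)"
    have "M' \<in> \<A>"
      unfolding \<A>_def
    proof (intro CollectI conjI)
      show "subspace M'" by (simp add: M'_def)
      show "G \<subseteq> M'" using M(2) span_superset[of "insert (x, c) M"] by (auto simp: M'_def)
      show "\<forall>(w, d)\<in>M'. d \<le> p w"
      proof safe
        fix w d assume "(w, d) \<in> M'"
        then obtain t where "(w, d) - t *\<^sub>R (x, c) \<in> span M"
          unfolding M'_def span_insert by blast
        then have "(w - t *\<^sub>R x, d - t * c) \<in> M" using M(1) by (simp add: span_eq_iff[THEN iffD2])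
        from bound[OF this, of t] show "d \<le> p w" by simp
      qed
    qed
    then have "M' = M"
      by (rule maximal) (use span_superset[of "insert (x, c) M"] in \<open>auto simp: M'_def\<close>)
    then have "(x, c) \<in> M" using span_base[of "(x, c)" "insert (x, c) M"] by (auto simp: M'_def)
    then show ?thesis by blast
  qed
  then obtain U where U: "\<And>x. (x, U x) \<in> M" by metis
  have "linear U"
  proof (rule linearI)
    show "U (x + y) = U x + U y" for x y
      using subspace_add[OF M(1) U U, of x y] by (intro unique[OF U]) simp
    show "U (r *\<^sub>R x) = r *\<^sub>R U x" for r x
      using subspace_scale[OF M(1) U, of r x] by (intro unique[OF U]) simp
  qed
  moreover have "\<forall>(x, a)\<in>G. U x = a" using unique[OF U] M(2) by blast
  moreover have "\<forall>x. U x \<le> p x" using M_le[OF U] by blast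
  ultimately show ?thesis by blast
qed

text \<open>A complex-linear functional is determined by its real part \<open>U\<close>, as \<open>x \<mapsto> U x - \<i> U (\<i> x)\<close>. This
  transfers the real extension theorem to complex scalars without loss in the norm.\<close>

lemma ex_clinfun_with_Re:
  fixes U :: "'a::complex_normed_vector \<Rightarrow> real"
  assumes lin: "linear U" and le: "\<And>x. U x \<le> K * norm x" and K: "K \<ge> 0"
  shows "\<exists>\<psi> :: 'a \<Rightarrow>\<^sub>C\<^sub>L complex. norm \<psi> \<le> K \<and> (\<forall>x. Re (clinfun_apply \<psi> x) = U x)"
proof -
  define \<psi> where "\<psi> x = Complex (U x) (- U (\<i> *\<^sub>C x))" for x
  have ii: "\<i> *\<^sub>C \<i> *\<^sub>C x = - x" for x :: 'a
    using scaleC_of_real[of "-1" x] by simp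
  have scaleC_Re_Im: "c *\<^sub>C x = Re c *\<^sub>R x + Im c *\<^sub>R (\<i> *\<^sub>C x)" for c and x :: 'a
    by (subst complex_eq[of c]) (simp add: scaleC_add_left scaleC_of_real[symmetric] mult.commute)
  have add: "\<psi> (x + y) = \<psi> x + \<psi> y" for x y
    by (simp add: \<psi>_def linear_add[OF lin] scaleC_add_right complex_eq_iff)
  have scale: "\<psi> (c *\<^sub>C x) = c * \<psi> x" for c x
  proof -
    have "U (c *\<^sub>C x) = Re c * U x + Im c * U (\<i> *\<^sub>C x)" for c x
      by (subst scaleC_Re_Im) (simp add: linear_add[OF lin] linear_scale[OF lin])
    from this[of c x] this[of "\<i> * c" x] show ?thesis
      by (simp add: \<psi>_def complex_eq_iff algebra_simps)
  qed
  have bound: "cmod (\<psi> x) \<le> K * norm x" for x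
  proof (cases "\<psi> x = 0")
    case False
    \<comment> \<open>Rotate \<open>x\<close> so that the value becomes real.\<close>
    define c where "c = cmod (\<psi> x) / \<psi> x"
    have "\<psi> (c *\<^sub>C x) = complex_of_real (cmod (\<psi> x))" using False by (simp add: scale c_def)
    then have "cmod (\<psi> x) = U (c *\<^sub>C x)"
      by (metis Re_complex_of_real \<psi>_def complex.sel(1))
    also have "\<dots> \<le> K * norm (c *\<^sub>C x)" by (rule le)
    also have "cmod c = 1" using False by (simp add: c_def norm_divide)
    then have "norm (c *\<^sub>C x) = norm x" by simp
    finally show ?thesis .
  qed (use K in simp)
  have "bounded_clinear \<psi>"
    by (rule bounded_clinearI[where K = K]) (simp_all add: add scale bound scaleC_complex_def)
  then have \<psi>: "clinfun_apply (Clinfun \<psi>) = \<psi>" by (simp add: Clinfun_inverse)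
  show ?thesis
    by (rule exI[of _ "Clinfun \<psi>"])
      (use K bound in \<open>auto simp: \<psi> intro!: norm_clinfun_bound, simp add: \<psi>_def\<close>)
qed

text \<open>It is enough to extend the real part from \<open>N\<close>: two complex functionals with the same real part on
  a complex subspace agree there.\<close>

theorem clinfun_hahn_banach:
  fixes \<phi> :: "'a::complex_normed_vector \<Rightarrow>\<^sub>C\<^sub>L complex"
  assumes N: "complex_vector.subspace N" and K: "K \<ge> 0"
    and le: "\<And>x. x \<in> N \<Longrightarrow> cmod (clinfun_apply \<phi> x) \<le> K * norm x"
  shows "\<exists>\<psi>. norm \<psi> \<le> K \<and> (\<forall>x\<in>N. clinfun_apply \<psi> x = clinfun_apply \<phi> x)"
proof -
  have lin: "linear (\<lambda>x. Re (clinfun_apply \<phi> x))"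
    by (intro bounded_linear.linear bounded_linear_compose[OF bounded_linear_Re]
        bounded_linear_clinfun_apply)
  define G where "G = (\<lambda>x. (x, Re (clinfun_apply \<phi> x))) ` N"
  have "\<exists>U. linear U \<and> (\<forall>(x, a)\<in>G. U x = a) \<and> (\<forall>x. U x \<le> K * norm x)"
  proof (rule sublinear_dominated_extension)
    show "K * norm (x + y) \<le> K * norm x + K * norm y" for x y :: 'a
      using mult_left_mono[OF norm_triangle_ineq K] by (simp add: distrib_left)
    have "subspace N"
      by (rule csubspace_imp_subspace[OF N])
    then show "subspace G"
      unfolding G_def by (intro linear_subspace_image)
        (auto intro!: linearI simp: linear_add[OF lin] linear_scale[OF lin])
    show "a \<le> K * norm x" if "(x, a) \<in> G" for x a
      using that le[of x] complex_Re_le_cmod[of "clinfun_apply \<phi> x"] by (auto simp: G_def)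
  qed simp
  then obtain U where U: "linear U" "\<And>x. x \<in> N \<Longrightarrow> U x = Re (clinfun_apply \<phi> x)"
    "\<And>x. U x \<le> K * norm x" by (auto simp: G_def)
  from ex_clinfun_with_Re[OF U(1,3) K] obtain \<psi> :: "'a \<Rightarrow>\<^sub>C\<^sub>L complex"
    where \<psi>: "norm \<psi> \<le> K" "\<And>x. Re (clinfun_apply \<psi> x) = U x" by blast
  have Im: "Im (clinfun_apply \<eta> x) = - Re (clinfun_apply \<eta> (\<i> *\<^sub>C x))"
    for \<eta> :: "'a \<Rightarrow>\<^sub>C\<^sub>L complex" and x
    by (simp add: clinfun_apply_scaleC scaleC_complex_def)
  have "clinfun_apply \<psi> x = clinfun_apply \<phi> x" if "x \<in> N" for x
    using that complex_vector.subspace_scale[OF N that, of \<i>]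
    by (intro complex_eqI) (simp_all add: Im \<psi> U)
  with \<psi>(1) show ?thesis by blast
qed

lemma ex_norming_functional:
  fixes y :: "'a::complex_normed_vector"
  shows "\<exists>\<psi> :: 'a \<Rightarrow>\<^sub>C\<^sub>L complex. norm \<psi> \<le> 1 \<and> clinfun_apply \<psi> y = complex_of_real (norm y)"
proof -
  define G where "G = span {(y, norm y)}"
  have "\<exists>U. linear U \<and> (\<forall>(x, a)\<in>G. U x = a) \<and> (\<forall>x. U x \<le> norm x)"
  proof (rule sublinear_dominated_extension)
    show "a \<le> norm x" if "(x, a) \<in> G" for x a
    proof -
      from that obtain t where "x = t *\<^sub>R y" "a = t * norm y"
        by (auto simp: G_def span_singleton)
      then show ?thesis by (simp add: mult_right_mono)
    qed
  qed (auto simp: G_def norm_triangle_ineq)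
  then obtain U where U: "linear U" "U y = norm y" "\<And>x. U x \<le> 1 * norm x"
    by (force simp: G_def intro: span_base)
  from ex_clinfun_with_Re[OF U(1,3)] obtain \<psi> :: "'a \<Rightarrow>\<^sub>C\<^sub>L complex"
    where \<psi>: "norm \<psi> \<le> 1" "\<And>x. Re (clinfun_apply \<psi> x) = U x" by auto
  have "cmod (clinfun_apply \<psi> y) \<le> norm \<psi> * norm y" by (rule norm_clinfun)
  also have "\<dots> \<le> norm y" using \<psi>(1) by (simp add: mult_left_le_one_le)
  finally have "(cmod (clinfun_apply \<psi> y))\<^sup>2 \<le> (norm y)\<^sup>2" by (rule power_mono) simp
  then have "(Im (clinfun_apply \<psi> y))\<^sup>2 \<le> 0" by (simp add: cmod_power2 \<psi>(2) U(2))
  then have "clinfun_apply \<psi> y = complex_of_real (norm y)"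
    by (intro complex_eqI) (simp_all add: \<psi>(2) U(2))
  with \<psi>(1) show ?thesis by blast
qed

lemma clinfun_separates:
  fixes x y :: "'a::complex_normed_vector"
  assumes "\<And>l :: 'a \<Rightarrow>\<^sub>C\<^sub>L complex. clinfun_apply l x = clinfun_apply l y"
  shows "x = y"
proof -
  obtain l :: "'a \<Rightarrow>\<^sub>C\<^sub>L complex" where "clinfun_apply l (x - y) = complex_of_real (norm (x - y))"
    using ex_norming_functional by blast
  moreover have "clinfun_apply l (x - y) = 0"
    using assms[of l] by (simp add: clinfun_apply_diff)
  ultimately show ?thesis by simp
qed

lemma norm_le_if_functionals_le:
  fixes y :: "'a::complex_normed_vector"
  assumes "\<And>l :: 'a \<Rightarrow>\<^sub>C\<^sub>L complex. norm l \<le> 1 \<Longrightarrow> cmod (clinfun_apply l y) \<le> K"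
  shows "norm y \<le> K"
  using ex_norming_functional[of y] assms by (metis norm_of_real abs_norm_cancel)

section \<open>Evaluation is holomorphic into the predual\<close>

text \<open>Taylor's formula on the unit disc, with the second derivative bounded by the Cauchy estimate on
  circles of radius \<open>R / 2\<close>. Such circles around points of the closed unit disc stay in the domain
  because \<open>R > 2\<close>.\<close>

lemma holomorphic_first_order_remainder:
  assumes hol: "g holomorphic_on ball 0 R" and R: "R > 2"
    and bound: "\<And>z. z \<in> ball 0 R \<Longrightarrow> cmod (g z) \<le> M"
  shows "cmod (g 1 - g 0 - deriv g 0) \<le> 8 * M / R\<^sup>2"
proof -
  have sub: "cball z (R / 2) \<subseteq> ball 0 R" if "z \<in> cball 0 1" for z :: complex
  proof
    fix w assume "w \<in> cball z (R / 2)"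
    then show "w \<in> ball 0 R"
      using that R norm_triangle_sub[of w z] by (simp add: dist_norm norm_minus_commute)
  qed
  have second: "cmod ((deriv ^^ 2) g z) \<le> 8 * M / R\<^sup>2" if z: "z \<in> cball 0 1" for z
  proof -
    have hol': "g holomorphic_on cball z (R / 2)"
      using hol sub[OF z] by (rule holomorphic_on_subset)
    have "cmod ((deriv ^^ 2) g z) \<le> fact 2 * M / (R / 2) ^ 2"
    proof (rule Cauchy_inequality)
      show "g holomorphic_on ball z (R / 2)"
        using hol' by (rule holomorphic_on_subset) auto
      show "continuous_on (cball z (R / 2)) g"
        using hol' by (rule holomorphic_on_imp_continuous_on)
      show "cmod (g x) \<le> M" if x: "cmod (z - x) = R / 2" for x
        using subsetD[OF sub[OF z], of x] x by (intro bound) (auto simp: dist_norm)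
    qed (use R in simp)
    then show ?thesis by (simp add: power_divide fact_numeral)
  qed
  have "cmod ((deriv ^^ 0) g 1 - (\<Sum>i\<le>1. (deriv ^^ i) g 0 * (1 - 0) ^ i / fact i))
      \<le> 8 * M / R\<^sup>2 * cmod (1 - 0) ^ Suc 1 / fact 1"
  proof (rule complex_Taylor[where S = "cball 0 1" and f = "\<lambda>i. (deriv ^^ i) g"])
    show "((deriv ^^ i) g has_field_derivative (deriv ^^ Suc i) g x) (at x within cball 0 1)"
      if x: "x \<in> cball 0 1" for i x
    proof -
      have "(deriv ^^ i) g holomorphic_on ball 0 R"
        by (rule holomorphic_higher_deriv[OF hol open_ball])
      then have "((deriv ^^ i) g has_field_derivative deriv ((deriv ^^ i) g) x) (at x)"
        by (rule holomorphic_derivI) (use x R in auto)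
      then show ?thesis by (auto intro: has_field_derivative_at_within)
    qed
  qed (use second in \<open>auto simp: numeral_2_eq_2\<close>)
  then show ?thesis by (simp add: algebra_simps)
qed

abbreviation hollip_deriv ::
    "('a::complex_normed_vector, 'b::complex_normed_vector) hollip \<Rightarrow> 'a \<Rightarrow> 'a \<Rightarrow> 'b"
  where "hollip_deriv f x \<equiv> frechet_derivative (hollip_apply f) (at x)"

lemma hollip_has_derivative:
  fixes f :: "('a::complex_normed_vector, 'b::complex_normed_vector) hollip"
  assumes "x \<in> ball 0 1"
  shows "(hollip_apply f has_derivative hollip_deriv f x) (at x)"
    and "bounded_clinear (hollip_deriv f x)"
proof -
  obtain D where "bounded_clinear D" "(hollip_apply f has_derivative D) (at x)"
    using holomorphic_lipschitz_holomorphic[OF holomorphic_lipschitz_hollip_apply, of f] assms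
    unfolding holomorphic_map_on_def by blast
  moreover from this(2) have "D = hollip_deriv f x" by (rule frechet_derivative_at)
  ultimately show "(hollip_apply f has_derivative hollip_deriv f x) (at x)"
    "bounded_clinear (hollip_deriv f x)" by simp_all
qed

lemma norm_hollip_deriv_le:
  assumes x: "x \<in> ball 0 1"
  shows "norm (hollip_deriv f x h) \<le> norm f * norm h"
proof -
  have "norm (hollip_deriv f x h) \<le> lipschitz_const (hollip_apply f) * norm h"
    by (rule has_derivative_lipschitz_bound[OF hollip_lipschitz open_ball x
          hollip_has_derivative(1)[OF x]])
  also have "\<dots> \<le> norm f * norm h"
    by (intro mult_right_mono lipschitz_const_hollip_le_norm) simp
  finally show ?thesis .
qed

text \<open>Restrict \<open>f\<close> to the complex line \<open>z \<mapsto> x + z h\<close>, which stays in the ball for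
  \<open>\<bar>z\<bar> < (1 - \<parallel>x\<parallel>) / \<parallel>h\<parallel>\<close>. The bound depends on \<open>f\<close> only through its norm, so it is
  a bound for the functional \<open>f \<mapsto> f (x + h) - f x - D f (x) h\<close>.\<close>

lemma hollip_first_order_remainder:
  fixes f :: "('a::complex_normed_vector, complex) hollip"
  assumes x: "norm x < 1" and h: "2 * norm h < 1 - norm x"
  shows "cmod (hollip_apply f (x + h) - hollip_apply f x - hollip_deriv f x h)
    \<le> 8 / (1 - norm x)\<^sup>2 * (norm h)\<^sup>2 * norm f"
proof (cases "h = 0")
  case True
  have "hollip_deriv f x 0 = 0"
    using linear_0[OF has_derivative_linear[OF hollip_has_derivative(1), of x f]] x by simp
  then show ?thesis using True x by simp
next
  case False
  define R where "R = (1 - norm x) / norm h"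
  define g where "g z = hollip_apply f (x + z *\<^sub>C h)" for z
  have R: "R > 2" using False h by (simp add: R_def field_simps)
  have g: "(g has_field_derivative hollip_deriv f (x + z *\<^sub>C h) h) (at z)" if "z \<in> ball 0 R" for z
  proof -
    have "norm (x + z *\<^sub>C h) \<le> norm x + cmod z * norm h"
      using norm_triangle_ineq[of x "z *\<^sub>C h"] by simp
    also have "cmod z * norm h < R * norm h"
      using that False by (intro mult_strict_right_mono) auto
    finally have in_ball: "x + z *\<^sub>C h \<in> ball 0 1" using False by (simp add: R_def)
    have "bounded_linear (\<lambda>z. z *\<^sub>C h)"
      by (rule bounded_linear_intro[where K = "norm h"])
        (simp_all add: scaleC_add_left scaleR_conv_of_real flip: scaleC_of_real)
    then have "((\<lambda>z. z *\<^sub>C h) has_derivative (\<lambda>z. z *\<^sub>C h)) (at z)"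
      by (rule bounded_linear_imp_has_derivative)
    then have "((\<lambda>z. x + z *\<^sub>C h) has_derivative (\<lambda>z. z *\<^sub>C h)) (at z)"
      using has_derivative_add[OF has_derivative_const[of x]] by fastforce
    from has_derivative_compose[OF this hollip_has_derivative(1)[OF in_ball, of f]]
    have "(g has_derivative (\<lambda>w. hollip_deriv f (x + z *\<^sub>C h) (w *\<^sub>C h))) (at z)"
      by (simp add: g_def[abs_def])
    moreover have "hollip_deriv f (x + z *\<^sub>C h) (w *\<^sub>C h) = hollip_deriv f (x + z *\<^sub>C h) h * w" for w
      using hollip_has_derivative(2)[OF in_ball, of f]
      by (simp add: bounded_clinear_def scaleC_complex_def)
    ultimately show ?thesis by (simp add: has_field_derivative_def)
  qed
  have "cmod (g 1 - g 0 - deriv g 0) \<le> 8 * norm f / R\<^sup>2"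
  proof (rule holomorphic_first_order_remainder[OF _ R])
    show "g holomorphic_on ball 0 R"
      using g unfolding holomorphic_on_open[OF open_ball] by blast
    show "cmod (g z) \<le> norm f" for z by (simp add: g_def norm_hollip_apply_le)
  qed
  moreover have "deriv g 0 = hollip_deriv f x h"
    using g[of 0, THEN DERIV_imp_deriv] R by simp
  ultimately show ?thesis by (simp add: g_def R_def power_divide field_simps)
qed

lemma bounded_clinear_hollip_deriv:
  assumes x: "x \<in> ball 0 1"
  shows "bounded_clinear
    (\<lambda>f :: ('a::complex_normed_vector, 'b::complex_normed_vector) hollip. hollip_deriv f x h)"
  unfolding bounded_clinear_def
proof (intro conjI allI)
  note D = hollip_has_derivative(1)[OF x]
  have add: "hollip_deriv (f + g) x = (\<lambda>h. hollip_deriv f x h + hollip_deriv g x h)"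
    for f g :: "('a, 'b) hollip"
    unfolding plus_hollip.rep_eq
    by (rule frechet_derivative_at[symmetric]) (intro has_derivative_add D)
  have scale: "hollip_deriv (c *\<^sub>C f) x = (\<lambda>h. c *\<^sub>C hollip_deriv f x h)"
    for c and f :: "('a, 'b) hollip"
    unfolding scaleC_hollip.rep_eq
    by (rule frechet_derivative_at[symmetric])
      (rule bounded_linear.has_derivative[OF scaleC_right_bounded_linear D])
  show "hollip_deriv (c *\<^sub>C f) x h = c *\<^sub>C hollip_deriv f x h" for c and f :: "('a, 'b) hollip"
    by (simp add: scale)
  show "bounded_linear (\<lambda>f :: ('a, 'b) hollip. hollip_deriv f x h)"
  proof (rule bounded_linear_intro[where K = "norm h"])
    show "hollip_deriv (r *\<^sub>R f) x h = r *\<^sub>R hollip_deriv f x h" for r and f :: "('a, 'b) hollip"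
      by (simp add: scale flip: scaleC_of_real)
    show "norm (hollip_deriv f x h) \<le> norm f * norm h" for f :: "('a, 'b) hollip"
      by (rule norm_hollip_deriv_le[OF x])
  qed (simp add: add)
qed

text \<open>Only of interest for \<open>x\<close> in the open unit ball; elsewhere the function under \<open>Clinfun\<close> need not be
  bounded or linear.\<close>

definition deriv_functional ::
    "'a::complex_normed_vector \<Rightarrow> 'a \<Rightarrow> ('a, complex) hollip \<Rightarrow>\<^sub>C\<^sub>L complex"
  where "deriv_functional x h = Clinfun (\<lambda>f. hollip_deriv f x h)"

lemma deriv_functional_apply:
  "x \<in> ball 0 1 \<Longrightarrow> clinfun_apply (deriv_functional x h) f = hollip_deriv f x h"
  by (simp add: deriv_functional_def Clinfun_inverse bounded_clinear_hollip_deriv)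

lemma bounded_clinear_deriv_functional:
  assumes x: "x \<in> ball (0 :: 'a::complex_normed_vector) 1"
  shows "bounded_clinear (deriv_functional x)"
  unfolding bounded_clinear_def
proof (intro conjI allI)
  have D: "bounded_clinear (hollip_deriv f x)" for f :: "('a, complex) hollip"
    by (rule hollip_has_derivative(2)[OF x])
  show "deriv_functional x (c *\<^sub>C h) = c *\<^sub>C deriv_functional x h" for c h
    using D by (intro clinfun_eqI)
      (simp add: deriv_functional_apply[OF x] scaleC_clinfun.rep_eq bounded_clinear_def)
  show "bounded_linear (deriv_functional x)"
  proof (rule bounded_linear_intro[where K = 1])
    have lin: "linear (hollip_deriv f x)" for f :: "('a, complex) hollip"
      using D by (simp add: bounded_clinear_def bounded_linear.linear)
    show "deriv_functional x (h + k) = deriv_functional x h + deriv_functional x k" for h k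
      by (intro clinfun_eqI)
        (simp add: deriv_functional_apply[OF x] plus_clinfun.rep_eq linear_add[OF lin])
    show "deriv_functional x (r *\<^sub>R h) = r *\<^sub>R deriv_functional x h" for r h
      by (intro clinfun_eqI)
        (simp add: deriv_functional_apply[OF x] scaleR_clinfun.rep_eq linear_scale[OF lin])
    show "norm (deriv_functional x h) \<le> norm h * 1" for h
      by (rule norm_clinfun_bound)
        (use norm_hollip_deriv_le[OF x] in \<open>auto simp: deriv_functional_apply[OF x] mult.commute\<close>)
  qed
qed

lemma eval_functional_has_derivative:
  fixes x :: "'a::complex_normed_vector"
  assumes x: "x \<in> ball 0 1"
  shows "(eval_functional has_derivative deriv_functional x) (at x)"
  unfolding has_derivative_at_alt
proof (intro conjI allI impI)
  show "bounded_linear (deriv_functional x)"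
    using bounded_clinear_deriv_functional[OF x] by (simp add: bounded_clinear_def)
  fix e :: real assume e: "e > 0"
  define s where "s = 1 - norm x"
  have s: "s > 0" using x by (simp add: s_def)
  show "\<exists>d>0. \<forall>y. norm (y - x) < d \<longrightarrow>
    norm (eval_functional y - eval_functional x - deriv_functional x (y - x)) \<le> e * norm (y - x)"
  proof (intro exI[of _ "min (s / 2) (e * s\<^sup>2 / 8)"] conjI allI impI)
    fix y assume y: "norm (y - x) < min (s / 2) (e * s\<^sup>2 / 8)"
    have "norm (eval_functional y - eval_functional x - deriv_functional x (y - x))
        \<le> 8 / s\<^sup>2 * (norm (y - x))\<^sup>2"
    proof (rule norm_clinfun_bound)
      fix f :: "('a, complex) hollip"
      show "norm (clinfun_apply
            (eval_functional y - eval_functional x - deriv_functional x (y - x)) f)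
          \<le> 8 / s\<^sup>2 * (norm (y - x))\<^sup>2 * norm f"
        using hollip_first_order_remainder[of x "y - x" f] x y
        by (simp add: s_def minus_clinfun.rep_eq eval_functional.rep_eq deriv_functional_apply[OF x])
    qed simp
    also have "\<dots> = 8 / s\<^sup>2 * norm (y - x) * norm (y - x)" by (simp add: power2_eq_square)
    also have "\<dots> \<le> e * norm (y - x)"
      using y s by (intro mult_right_mono) (auto simp: field_simps)
    finally show "norm (eval_functional y - eval_functional x - deriv_functional x (y - x))
      \<le> e * norm (y - x)" .
  qed (use e s in auto)
qed

lemma has_derivative_in_closed_subspace:
  fixes f :: "'a::real_normed_vector \<Rightarrow> 'b::real_normed_vector"
  assumes S: "subspace S" "closed S" and U: "open U" "x \<in> U" and f: "\<And>y. y \<in> U \<Longrightarrow> f y \<in> S"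
    and D: "(f has_derivative D) (at x)"
  shows "D h \<in> S"
proof -
  have "((\<lambda>t::real. x + t *\<^sub>R h) has_derivative (\<lambda>t. t *\<^sub>R h)) (at 0)"
    by (auto intro!: derivative_eq_intros)
  moreover have "(f has_derivative D) (at (x + 0 *\<^sub>R h))" using D by simp
  ultimately have "((\<lambda>t. f (x + t *\<^sub>R h)) has_derivative (\<lambda>t. D (t *\<^sub>R h))) (at 0)"
    by (rule has_derivative_compose)
  then have "((\<lambda>t. norm (f (x + t *\<^sub>R h) - f x - t *\<^sub>R D h) / norm t) \<longlongrightarrow> 0) (at 0)"
    using linear_scale[OF has_derivative_linear[OF D]] by (simp add: has_derivative_at)
  moreover have "norm (f (x + t *\<^sub>R h) - f x - t *\<^sub>R D h) / norm t
      = norm ((1 / t) *\<^sub>R (f (x + t *\<^sub>R h) - f x) - D h)" if "t \<noteq> 0" for t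
  proof -
    have "(1 / t) *\<^sub>R (f (x + t *\<^sub>R h) - f x) - D h
        = (1 / t) *\<^sub>R (f (x + t *\<^sub>R h) - f x - t *\<^sub>R D h)"
      using that by (simp add: scaleR_diff_right)
    then show ?thesis by simp
  qed
  then have "\<forall>\<^sub>F t in at 0. norm (f (x + t *\<^sub>R h) - f x - t *\<^sub>R D h) / norm t
      = norm ((1 / t) *\<^sub>R (f (x + t *\<^sub>R h) - f x) - D h)"
    by (auto simp: eventually_at_filter)
  ultimately have "((\<lambda>t. norm ((1 / t) *\<^sub>R (f (x + t *\<^sub>R h) - f x) - D h)) \<longlongrightarrow> 0) (at 0)"
    by (rule Lim_transform_eventually)
  then have lim: "((\<lambda>t. (1 / t) *\<^sub>R (f (x + t *\<^sub>R h) - f x)) \<longlongrightarrow> D h) (at 0)"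
    by (rule LIM_zero_cancel[OF tendsto_norm_zero_cancel])
  have "((\<lambda>t::real. x + t *\<^sub>R h) \<longlongrightarrow> x + 0 *\<^sub>R h) (at 0)" by (intro tendsto_intros)
  then have "\<forall>\<^sub>F t in at 0. x + t *\<^sub>R h \<in> U"
    using U by (auto dest: topological_tendstoD)
  then have "\<forall>\<^sub>F t in at 0. (1 / t) *\<^sub>R (f (x + t *\<^sub>R h) - f x) \<in> S"
    by eventually_elim (intro subspace_scale subspace_diff S f U)
  from Lim_in_closed_set[OF S(2) this _ lim] show ?thesis by simp
qed

text \<open>The derivative of \<open>\<delta>\<close>, first taken in the full dual space, is a limit of difference quotients of
  evaluations and so stays in the closed span.\<close>

lemma deriv_functional_in_predual_set:
  fixes x :: "'a::complex_normed_vector"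
  assumes x: "x \<in> ball 0 1"
  shows "deriv_functional x h \<in> predual_set"
proof (rule has_derivative_in_closed_subspace[OF _ _ open_ball x _
        eval_functional_has_derivative[OF x]])
  show "subspace (predual_set :: (('a, complex) hollip \<Rightarrow>\<^sub>C\<^sub>L complex) set)"
    by (rule csubspace_imp_subspace[OF csubspace_predual_set])
  show "closed (predual_set :: (('a, complex) hollip \<Rightarrow>\<^sub>C\<^sub>L complex) set)"
    by (simp add: predual_set_def)
qed (rule eval_functional_in_predual_set)

lemma holomorphic_map_on_delta: "holomorphic_map_on delta (ball (0 :: 'a::complex_normed_vector) 1)"
  unfolding holomorphic_map_on_def
proof (intro ballI exI conjI)
  fix x :: 'a assume x: "x \<in> ball 0 1"
  define D where "D h = Predual (deriv_functional x h)" for h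
  have D: "predual_functional (D h) = deriv_functional x h" for h
    by (simp add: D_def Predual_inverse deriv_functional_in_predual_set[OF x])
  show bcl: "bounded_clinear D"
    using bounded_clinear_deriv_functional[OF x]
    unfolding bounded_clinear_def bounded_linear_def bounded_linear_axioms_def linear_iff
    by (simp add: predual_functional_inject[symmetric] D norm_predual.rep_eq
        plus_predual.rep_eq scaleR_predual.rep_eq scaleC_predual.rep_eq)
  show "(delta has_derivative D) (at x)"
    unfolding has_derivative_at_alt
  proof (intro conjI allI impI)
    show "bounded_linear D" using bcl by (simp add: bounded_clinear_def)
    fix e :: real assume "e > 0"
    then obtain d where d: "d > 0" "\<And>y. norm (y - x) < d \<Longrightarrow>
        norm (eval_functional y - eval_functional x - deriv_functional x (y - x))
          \<le> e * norm (y - x)"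
      using eval_functional_has_derivative[OF x] unfolding has_derivative_at_alt by blast
    show "\<exists>d>0. \<forall>y. norm (y - x) < d \<longrightarrow>
      norm (delta y - delta x - D (y - x)) \<le> e * norm (y - x)"
    proof (intro exI[of _ "min d (1 - norm x)"] conjI allI impI)
      fix y assume y: "norm (y - x) < min d (1 - norm x)"
      then have "y \<in> ball 0 1" using norm_triangle_sub[of y x] by simp
      then show "norm (delta y - delta x - D (y - x)) \<le> e * norm (y - x)"
        using d(2)[of y] y x
        by (simp add: norm_predual.rep_eq minus_predual.rep_eq predual_functional_delta D)
    qed (use d x in auto)
  qed
qed

text \<open>Pairing \<open>\<delta> x - \<delta> y\<close> with \<open>f\<close> gives \<open>f x - f y\<close>, and the Lipschitz constant is part of the norm.\<close>

lemma norm_delta_diff_le: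
  assumes "x \<in> ball 0 1" "y \<in> ball 0 1"
  shows "norm (delta x - delta y) \<le> norm (x - y)"
proof -
  have "norm (eval_functional x - eval_functional y) \<le> norm (x - y)"
  proof (rule norm_clinfun_bound)
    fix f :: "('a, complex) hollip"
    have "norm (hollip_apply f x - hollip_apply f y)
        \<le> lipschitz_const (hollip_apply f) * norm (x - y)"
      by (rule lipschitz_on_normD[OF hollip_lipschitz assms])
    also have "\<dots> \<le> norm f * norm (x - y)"
      by (intro mult_right_mono lipschitz_const_hollip_le_norm) simp
    finally show "norm (clinfun_apply (eval_functional x - eval_functional y) f)
      \<le> norm (x - y) * norm f"
      by (simp add: minus_clinfun.rep_eq eval_functional.rep_eq mult.commute)
  qed simp
  then show ?thesis
    by (simp add: norm_predual.rep_eq minus_predual.rep_eq predual_functional_delta[OF assms(1)]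
        predual_functional_delta[OF assms(2)])
qed

lemma norm_delta_le:
  assumes "x \<in> ball 0 1"
  shows "norm (delta x) \<le> 1"
proof -
  have "norm (eval_functional x) \<le> 1"
    by (rule norm_clinfun_bound) (simp_all add: eval_functional.rep_eq norm_hollip_apply_le)
  then show ?thesis by (simp only: norm_predual.rep_eq predual_functional_delta[OF assms])
qed

section \<open>The operator represented by a holomorphic Lipschitz map\<close>

lemma lipschitz_on_clinfun_compose:
  assumes "C-lipschitz_on S f"
  shows "(norm T * C)-lipschitz_on S (\<lambda>x. clinfun_apply T (f x))"
proof (rule lipschitz_onI)
  fix x y assume xy: "x \<in> S" "y \<in> S"
  have "dist (clinfun_apply T (f x)) (clinfun_apply T (f y)) \<le> norm T * dist (f x) (f y)"
    using norm_clinfun[of T "f x - f y"] by (simp add: dist_norm clinfun_apply_diff)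
  also have "\<dots> \<le> norm T * (C * dist x y)"
    by (intro mult_left_mono lipschitz_onD[OF assms xy]) simp
  finally show "dist (clinfun_apply T (f x)) (clinfun_apply T (f y)) \<le> norm T * C * dist x y"
    by (simp add: mult.assoc)
qed (use lipschitz_on_nonneg[OF assms] in simp)

lemma holomorphic_map_on_clinfun_compose:
  assumes "holomorphic_map_on f U"
  shows "holomorphic_map_on (\<lambda>x. clinfun_apply T (f x)) U"
  unfolding holomorphic_map_on_def
proof
  fix x assume "x \<in> U"
  then obtain D where "bounded_clinear D" "(f has_derivative D) (at x)"
    using assms unfolding holomorphic_map_on_def by blast
  then show "\<exists>D. bounded_clinear D \<and> ((\<lambda>x. clinfun_apply T (f x)) has_derivative D) (at x)"
    by (intro exI[of _ "\<lambda>h. clinfun_apply T (D h)"] conjI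
        bounded_clinear_compose[OF bounded_clinear_clinfun_apply]
        bounded_linear.has_derivative[OF bounded_linear_clinfun_apply])
qed

lift_definition hollip_compose ::
    "('b::complex_normed_vector \<Rightarrow>\<^sub>C\<^sub>L 'c::complex_normed_vector) \<Rightarrow>
      ('a::complex_normed_vector, 'b) hollip \<Rightarrow> ('a, 'c) hollip"
  is "\<lambda>T f x. clinfun_apply T (f x)"
  using lipschitz_on_clinfun_compose holomorphic_map_on_clinfun_compose clinfun_apply_zero
  unfolding holomorphic_lipschitz_def by metis

lemma norm_hollip_compose_le: "norm (hollip_compose T f) \<le> norm T * norm f"
proof -
  have "lipschitz_const (\<lambda>x. clinfun_apply T (hollip_apply f x))
      \<le> norm T * lipschitz_const (hollip_apply f)"
    by (rule lipschitz_const_le[OF lipschitz_on_clinfun_compose[OF hollip_lipschitz]])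
  then show ?thesis
    using norm_clinfun[of T "hollip_apply f 0"]
    by (simp add: norm_hollip.rep_eq hollip_compose.rep_eq distrib_left)
qed

lemma norm_hollip_compose_contraction_le:
  "norm T \<le> 1 \<Longrightarrow> norm (hollip_compose T f) \<le> norm f"
  using norm_hollip_compose_le[of T f] mult_left_le_one_le[of "norm f" "norm T"] by simp

text \<open>The map \<open>f\<close> induces an operator from functionals on scalar maps to the bidual of its target; on the
  predual its values are vectors of the target itself. Working in the bidual avoids checking that
  a sum of point evaluations determines the corresponding sum of values of \<open>f\<close>: that is built into
  testing against all functionals \<open>l\<close>.\<close>

lemma ex_vector_representing_functional:
  fixes f :: "('a::complex_normed_vector, 'b::complex_banach) hollip"
  assumes "\<phi> \<in> predual_set"
  shows "\<exists>y. \<forall>l :: 'b \<Rightarrow>\<^sub>C\<^sub>L complex. clinfun_apply l y = clinfun_apply \<phi> (hollip_compose l f)"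
proof -
  define rep where "rep \<phi> y \<longleftrightarrow>
      (\<forall>l :: 'b \<Rightarrow>\<^sub>C\<^sub>L complex. clinfun_apply l y = clinfun_apply \<phi> (hollip_compose l f))"
    for \<phi> :: "('a, complex) hollip \<Rightarrow>\<^sub>C\<^sub>L complex" and y
  define S where "S = {\<phi>. \<exists>y. rep \<phi> y}"
  have diff: "rep (\<phi> - \<psi>) (y - z)" if "rep \<phi> y" "rep \<psi> z" for \<phi> \<psi> y z
    using that by (simp add: rep_def clinfun_apply_diff minus_clinfun.rep_eq)
  have bound: "norm y \<le> norm \<phi> * norm f" if "rep \<phi> y" for \<phi> y
  proof -
    have "cmod (clinfun_apply l y) \<le> norm \<phi> * norm f"
      if "norm l \<le> 1" for l :: "'b \<Rightarrow>\<^sub>C\<^sub>L complex"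
    proof -
      have "cmod (clinfun_apply l y) \<le> norm \<phi> * norm (hollip_compose l f)"
        using \<open>rep \<phi> y\<close> by (simp add: rep_def norm_clinfun)
      also have "\<dots> \<le> norm \<phi> * norm f"
        using norm_hollip_compose_contraction_le[OF that] by (intro mult_left_mono) auto
      finally show ?thesis .
    qed
    then show ?thesis by (rule norm_le_if_functionals_le)
  qed
  have "complex_vector.subspace S"
  proof (rule complex_vector.subspaceI)
    have "rep 0 0" by (simp add: rep_def clinfun_apply_zero zero_clinfun.rep_eq)
    then show "0 \<in> S" by (auto simp: S_def)
    show "\<phi> + \<psi> \<in> S" if "\<phi> \<in> S" "\<psi> \<in> S" for \<phi> \<psi>
    proof -
      obtain y z where "rep \<phi> y" "rep \<psi> z" using \<open>\<phi> \<in> S\<close> \<open>\<psi> \<in> S\<close> by (auto simp: S_def)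
      then have "rep (\<phi> + \<psi>) (y + z)"
        by (simp add: rep_def clinfun_apply_add plus_clinfun.rep_eq)
      then show ?thesis by (auto simp: S_def)
    qed
    show "c *\<^sub>C \<phi> \<in> S" if "\<phi> \<in> S" for c \<phi>
    proof -
      obtain y where "rep \<phi> y" using \<open>\<phi> \<in> S\<close> by (auto simp: S_def)
      then have "rep (c *\<^sub>C \<phi>) (c *\<^sub>C y)"
        by (simp add: rep_def clinfun_apply_scaleC scaleC_clinfun.rep_eq)
      then show ?thesis by (auto simp: S_def)
    qed
  qed
  moreover have "eval_functional ` ball 0 1 \<subseteq> S"
  proof -
    have "rep (eval_functional x) (hollip_apply f x)" for x
      by (simp add: rep_def eval_functional.rep_eq hollip_compose.rep_eq)
    then show ?thesis by (auto simp: S_def)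
  qed
  ultimately have "cspan (eval_functional ` ball 0 1) \<subseteq> S"
    by (intro complex_vector.span_minimal)
  moreover have "closed S"
    unfolding closed_sequential_limits
  proof (intro allI impI, elim conjE)
    fix \<Phi> \<phi> assume \<Phi>: "\<forall>n. \<Phi> n \<in> S" "\<Phi> \<longlonglongrightarrow> \<phi>"
    then have "\<forall>n. \<exists>y. rep (\<Phi> n) y" by (simp add: S_def)
    then obtain y where y: "\<And>n. rep (\<Phi> n) (y n)" by metis
    have "Cauchy y"
    proof (rule CauchyI)
      fix e :: real assume e: "e > 0"
      have pos: "norm f + 1 > 0" by (simp add: add_nonneg_pos)
      with e have e': "e / (norm f + 1) > 0" by simp
      have "Cauchy \<Phi>" using \<Phi>(2) by (rule LIMSEQ_imp_Cauchy)
      from CauchyD[OF this e'] obtain M where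
        M: "\<And>m n. m \<ge> M \<Longrightarrow> n \<ge> M \<Longrightarrow> norm (\<Phi> m - \<Phi> n) < e / (norm f + 1)" by blast
      have "norm (y m - y n) < e" if "m \<ge> M" "n \<ge> M" for m n
      proof -
        have "norm (y m - y n) \<le> norm (\<Phi> m - \<Phi> n) * norm f" by (rule bound[OF diff[OF y y]])
        also have "\<dots> \<le> e / (norm f + 1) * norm f"
          using M[OF that] by (intro mult_right_mono) auto
        also have "\<dots> < e" using e by (simp add: pos_divide_less_eq[OF pos] distrib_left)
        finally show ?thesis .
      qed
      then show "\<exists>M. \<forall>m\<ge>M. \<forall>n\<ge>M. norm (y m - y n) < e" by blast
    qed
    then obtain z where z: "y \<longlonglongrightarrow> z" using Cauchy_convergent convergent_def by blast
    have "clinfun_apply l z = clinfun_apply \<phi> (hollip_compose l f)" for l :: "'b \<Rightarrow>\<^sub>C\<^sub>L complex"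
    proof (rule LIMSEQ_unique)
      show "(\<lambda>n. clinfun_apply l (y n)) \<longlonglongrightarrow> clinfun_apply l z"
        by (rule bounded_linear.tendsto[OF bounded_linear_clinfun_apply z])
      have "(\<lambda>n. norm (\<Phi> n - \<phi>) * norm (hollip_compose l f)) \<longlonglongrightarrow> 0"
        using \<Phi>(2) by (intro tendsto_mult_left_zero) (simp add: LIM_zero tendsto_norm_zero)
      then have "(\<lambda>n. clinfun_apply (\<Phi> n - \<phi>) (hollip_compose l f)) \<longlonglongrightarrow> 0"
        by (rule Lim_null_comparison[rotated]) (simp add: norm_clinfun)
      then have "(\<lambda>n. clinfun_apply (\<Phi> n) (hollip_compose l f))
          \<longlonglongrightarrow> clinfun_apply \<phi> (hollip_compose l f)"
        by (simp add: minus_clinfun.rep_eq LIM_zero_cancel)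
      then show "(\<lambda>n. clinfun_apply l (y n)) \<longlonglongrightarrow> clinfun_apply \<phi> (hollip_compose l f)"
        using y by (simp add: rep_def)
    qed
    then show "\<phi> \<in> S" by (auto simp: S_def rep_def)
  qed
  ultimately have "predual_set \<subseteq> S"
    unfolding predual_set_def by (rule closure_minimal)
  then show ?thesis using assms by (auto simp: S_def rep_def)
qed

lemma ex_operator_on_predual:
  fixes f :: "('a::complex_normed_vector, 'b::complex_banach) hollip"
  shows "\<exists>T :: 'a predual \<Rightarrow>\<^sub>C\<^sub>L 'b.
    (\<forall>x\<in>ball 0 1. hollip_apply f x = clinfun_apply T (delta x)) \<and> norm T \<le> norm f"
proof -
  have "\<exists>y. \<forall>l :: 'b \<Rightarrow>\<^sub>C\<^sub>L complex.
      clinfun_apply l y = clinfun_apply (predual_functional p) (hollip_compose l f)" for p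
    by (rule ex_vector_representing_functional[OF predual_functional])
  then obtain T where T: "\<And>p (l :: 'b \<Rightarrow>\<^sub>C\<^sub>L complex).
      clinfun_apply l (T p) = clinfun_apply (predual_functional p) (hollip_compose l f)"
    by metis
  have bound: "norm (T p) \<le> norm f * norm p" for p
  proof -
    have "cmod (clinfun_apply l (T p)) \<le> norm f * norm p"
      if "norm l \<le> 1" for l :: "'b \<Rightarrow>\<^sub>C\<^sub>L complex"
    proof -
      have "cmod (clinfun_apply l (T p)) \<le> norm p * norm (hollip_compose l f)"
        by (simp add: T norm_predual.rep_eq norm_clinfun)
      also have "\<dots> \<le> norm p * norm f"
        using norm_hollip_compose_contraction_le[OF that] by (intro mult_left_mono) auto
      finally show ?thesis by (simp add: mult.commute)
    qed
    then show ?thesis by (rule norm_le_if_functionals_le)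
  qed
  have "bounded_clinear T"
  proof (rule bounded_clinearI[OF _ _ bound])
    show "T (p + q) = T p + T q" for p q
      by (rule clinfun_separates)
        (simp add: T clinfun_apply_add plus_predual.rep_eq plus_clinfun.rep_eq)
    show "T (c *\<^sub>C p) = c *\<^sub>C T p" for c p
      by (rule clinfun_separates)
        (simp add: T clinfun_apply_scaleC scaleC_predual.rep_eq scaleC_clinfun.rep_eq)
  qed
  then have app: "clinfun_apply (Clinfun T) = T" by (simp add: Clinfun_inverse)
  have "hollip_apply f x = T (delta x)" if "x \<in> ball 0 1" for x
    by (rule clinfun_separates)
      (simp only: T predual_functional_delta[OF that] eval_functional.rep_eq hollip_compose.rep_eq)
  moreover have "norm (Clinfun T) \<le> norm f"
    by (rule norm_clinfun_bound) (use bound in \<open>auto simp: app\<close>)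
  ultimately show ?thesis by (intro exI[of _ "Clinfun T"]) (simp add: app)
qed

text \<open>The span of the evaluations is dense in the predual by construction; this is the form in which
  density is used to show that two operators on the predual agree.\<close>

lemma predual_eq_closed_csubspaceI:
  fixes S :: "'a::complex_normed_vector predual set"
  assumes S: "complex_vector.subspace S" "closed S" and delta: "delta ` ball 0 1 \<subseteq> S"
  shows "S = UNIV"
proof (intro equalityI subsetI UNIV_I)
  fix p :: "'a predual"
  have "complex_vector.subspace (predual_functional ` S)"
  proof (rule complex_vector.subspaceI)
    show "0 \<in> predual_functional ` S"
      using complex_vector.subspace_0[OF S(1)] by (auto simp flip: zero_predual.rep_eq)
    show "\<phi> + \<psi> \<in> predual_functional ` S"
      if "\<phi> \<in> predual_functional ` S" "\<psi> \<in> predual_functional ` S" for \<phi> \<psi>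
      using that complex_vector.subspace_add[OF S(1)] by (auto simp flip: plus_predual.rep_eq)
    show "c *\<^sub>C \<phi> \<in> predual_functional ` S" if "\<phi> \<in> predual_functional ` S" for c \<phi>
      using that complex_vector.subspace_scale[OF S(1)] by (auto simp flip: scaleC_predual.rep_eq)
  qed
  moreover have "eval_functional ` ball 0 1 \<subseteq> predual_functional ` S"
  proof
    fix \<phi> :: "('a, complex) hollip \<Rightarrow>\<^sub>C\<^sub>L complex"
    assume "\<phi> \<in> eval_functional ` ball 0 1"
    then obtain x where x: "x \<in> ball 0 1" "\<phi> = eval_functional x" by blast
    then have "\<phi> = predual_functional (delta x)" by (simp only: predual_functional_delta)
    then show "\<phi> \<in> predual_functional ` S" using delta x(1) by blast
  qed
  ultimately have span: "cspan (eval_functional ` ball 0 1) \<subseteq> predual_functional ` S"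
    by (intro complex_vector.span_minimal)
  have "predual_functional p \<in> closure (cspan (eval_functional ` ball 0 1))"
    using predual_functional[of p] by (simp add: predual_set_def)
  then obtain \<Phi> where \<Phi>: "\<And>n. \<Phi> n \<in> cspan (eval_functional ` ball 0 1)"
    "\<Phi> \<longlonglongrightarrow> predual_functional p"
    by (auto simp: closure_sequential)
  then have "\<forall>n. \<exists>q\<in>S. \<Phi> n = predual_functional q" using span by blast
  then obtain q where q: "\<And>n. q n \<in> S" "\<And>n. \<Phi> n = predual_functional (q n)" by metis
  have "q \<longlonglongrightarrow> p"
    using \<Phi>(2) by (simp add: LIMSEQ_iff q(2) norm_predual.rep_eq minus_predual.rep_eq)
  then show "p \<in> S" using closed_sequentially[OF S(2)] q(1) by blast
qed

lemma clinfun_eq_if_eq_on_delta: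
  fixes S T :: "'a::complex_normed_vector predual \<Rightarrow>\<^sub>C\<^sub>L 'b::complex_normed_vector"
  assumes "\<And>x. x \<in> ball 0 1 \<Longrightarrow> clinfun_apply S (delta x) = clinfun_apply T (delta x)"
  shows "S = T"
proof -
  have "{p. clinfun_apply S p = clinfun_apply T p} = UNIV"
  proof (rule predual_eq_closed_csubspaceI)
    show "complex_vector.subspace {p. clinfun_apply S p = clinfun_apply T p}"
      by (rule complex_vector.subspaceI)
        (auto simp: clinfun_apply_zero clinfun_apply_add clinfun_apply_scaleC)
    show "closed {p. clinfun_apply S p = clinfun_apply T p}"
      by (intro closed_Collect_eq continuous_on_clinfun_apply)
  qed (use assms in auto)
  then show ?thesis by (intro clinfun_eqI) blast
qed

lemma linearization_eqI:
  assumes "\<And>x. x \<in> ball 0 1 \<Longrightarrow> hollip_apply f x = clinfun_apply T (delta x)"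
  shows "linearization f = T"
  unfolding linearization_def
  by (rule the_equality) (use assms in \<open>auto intro!: clinfun_eq_if_eq_on_delta\<close>)

lemma linearization_delta:
  "x \<in> ball 0 1 \<Longrightarrow> clinfun_apply (linearization f) (delta x) = hollip_apply f x"
  using ex_operator_on_predual[of f] linearization_eqI[of f] by metis

lemma norm_linearization_le: "norm (linearization f) \<le> norm f"
  using ex_operator_on_predual[of f] linearization_eqI[of f] by metis

lemma lipschitz_on_clinfun_delta:
  "(norm T)-lipschitz_on (ball 0 1) (\<lambda>x. clinfun_apply T (delta x))"
proof -
  have "1-lipschitz_on (ball 0 1) (delta :: 'a \<Rightarrow> 'a predual)"
    by (rule lipschitz_onI) (simp_all only: dist_norm mult_1 norm_delta_diff_le zero_le_one)
  from lipschitz_on_clinfun_compose[OF this] show ?thesis by simp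
qed

text \<open>Both bounds come from \<open>f = T\<^sub>f \<circ> \<delta>\<close>: the map \<open>\<delta>\<close> is 1-Lipschitz and takes values of norm at most one.\<close>

lemma max_le_norm_linearization:
  "max (lipschitz_const (hollip_apply f)) (norm (hollip_apply f 0)) \<le> norm (linearization f)"
proof (rule max.boundedI)
  have "(norm (linearization f))-lipschitz_on (ball 0 1) (hollip_apply f)"
    by (rule lipschitz_on_transform[OF lipschitz_on_clinfun_delta]) (rule linearization_delta[symmetric])
  then show "lipschitz_const (hollip_apply f) \<le> norm (linearization f)"
    by (rule lipschitz_const_le)
  have "norm (hollip_apply f 0) \<le> norm (linearization f) * norm (delta (0 :: 'a))"
    using norm_clinfun[of "linearization f" "delta 0"] by (simp add: linearization_delta)
  also have "\<dots> \<le> norm (linearization f) * 1"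
    by (intro mult_left_mono norm_delta_le) auto
  finally show "norm (hollip_apply f 0) \<le> norm (linearization f)" by simp
qed

lemma half_norm_hollip_le_max:
  "1 / 2 * norm f \<le> max (lipschitz_const (hollip_apply f)) (norm (hollip_apply f 0))"
  unfolding norm_hollip.rep_eq by simp

section \<open>The isomorphism with the operators on the predual\<close>

text \<open>The preimage of \<open>T\<close> is \<open>T \<circ> \<delta>\<close>, which inherits holomorphy and the Lipschitz bound from \<open>\<delta>\<close>.\<close>

lemma surj_linearization:
  "surj (linearization :: ('a::complex_banach, 'b::complex_banach) hollip \<Rightarrow> _)"
proof (rule surjI)
  fix T :: "'a predual \<Rightarrow>\<^sub>C\<^sub>L 'b"
  define F where "F x = (if x \<in> ball 0 1 then clinfun_apply T (delta x) else 0)" for x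
  have "holomorphic_lipschitz F"
    unfolding holomorphic_lipschitz_def
  proof (intro conjI exI allI impI)
    show "(norm T)-lipschitz_on (ball 0 1) F"
      by (rule lipschitz_on_transform[OF lipschitz_on_clinfun_delta]) (simp add: F_def)
    show "holomorphic_map_on F (ball 0 1)"
      unfolding holomorphic_map_on_def
    proof
      fix x :: 'a assume x: "x \<in> ball 0 1"
      obtain D where D: "bounded_clinear D"
        "((\<lambda>x. clinfun_apply T (delta x)) has_derivative D) (at x)"
        using holomorphic_map_on_clinfun_compose[OF holomorphic_map_on_delta, of T] x
        unfolding holomorphic_map_on_def by blast
      have "(F has_derivative D) (at x)"
        by (rule has_derivative_transform_within_open[OF D(2) open_ball x]) (simp add: F_def)
      with D(1) show "\<exists>D. bounded_clinear D \<and> (F has_derivative D) (at x)" by blast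
    qed
  qed (simp add: F_def)
  then have "hollip_apply (Hollip F) = F" by (simp add: Hollip_inverse)
  then show "linearization (Hollip (\<lambda>x. if x \<in> ball 0 1 then clinfun_apply T (delta x) else 0)) = T"
    by (intro linearization_eqI) (simp add: F_def[abs_def])
qed

lemma linearization_add: "linearization (f + g) = linearization f + linearization g"
  by (rule linearization_eqI) (simp only: plus_hollip.rep_eq plus_clinfun.rep_eq linearization_delta)

lemma linearization_scaleC: "linearization (c *\<^sub>C f) = c *\<^sub>C linearization f"
  by (rule linearization_eqI)
    (simp only: scaleC_hollip.rep_eq scaleC_clinfun.rep_eq linearization_delta)

lemma linear_linearization:
  "Vector_Spaces.linear scaleC scaleC
    (linearization :: ('a::complex_banach, 'b::complex_banach) hollip \<Rightarrow> _)"
  by unfold_locales (simp_all add: linearization_add linearization_scaleC)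

lemma banach_isomorphism_linearization:
  "banach_isomorphism (linearization :: ('a::complex_banach, 'b::complex_banach) hollip \<Rightarrow> _)"
proof -
  let ?L = "linearization :: ('a, 'b) hollip \<Rightarrow> _"
  have le: "norm f \<le> 2 * norm (?L f)" for f
    using half_norm_hollip_le_max[of f] max_le_norm_linearization[of f] by linarith
  have L: "bounded_clinear ?L"
    by (rule bounded_clinearI[where K = 1])
      (simp_all add: linearization_add linearization_scaleC norm_linearization_le)
  have "inj ?L"
    by (rule injI, rule hollip_eqI) (metis linearization_delta)
  then have bij: "bij ?L" using surj_linearization by (simp add: bij_def)
  then have inv: "?L (inv ?L T) = T" "inv ?L (?L f) = f" for T f
    by (simp_all add: bij_is_surj surj_f_inv_f bij_is_inj inv_f_f)
  have "bounded_clinear (inv ?L)"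
  proof (rule bounded_clinearI)
    show "inv ?L (S + T) = inv ?L S + inv ?L T" for S T
      by (metis inv linearization_add)
    show "inv ?L (c *\<^sub>C T) = c *\<^sub>C inv ?L T" for c T
      by (metis inv linearization_scaleC)
    show "norm (inv ?L T) \<le> 2 * norm T" for T using le[of "inv ?L T"] by (simp add: inv)
  qed
  with L bij show ?thesis by (simp add: banach_isomorphism_def)
qed

text \<open>For scalar maps, \<open>f \<mapsto> T\<^sub>f\<close> is the canonical pairing, so the weak* topology is that of pointwise
  convergence on the predual.\<close>

lemma linearization_scalar:
  fixes f :: "('a::complex_banach, complex) hollip"
  shows "clinfun_apply (linearization f) p = clinfun_apply (predual_functional p) f"
proof -
  define T where "T p = clinfun_apply (predual_functional p) f" for p :: "'a predual"
  have "bounded_clinear T"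
  proof (rule bounded_clinearI[where K = "norm f"])
    show "norm (T p) \<le> norm f * norm p" for p
      using norm_clinfun[of "predual_functional p" f]
      by (simp add: T_def norm_predual.rep_eq mult.commute)
  qed (simp_all add: T_def plus_predual.rep_eq plus_clinfun.rep_eq scaleC_predual.rep_eq
      scaleC_clinfun.rep_eq)
  then have app: "clinfun_apply (Clinfun T) = T" by (simp add: Clinfun_inverse)
  have "linearization f = Clinfun T"
    by (rule linearization_eqI)
      (simp only: app T_def predual_functional_delta eval_functional.rep_eq)
  then show ?thesis by (simp add: app T_def)
qed

section \<open>Bounded sets: the three topologies agree\<close>

lemma subtopology_eqI:
  assumes "\<And>U. openin X U \<Longrightarrow> openin (subtopology Y B) (B \<inter> U)"
    and "\<And>U. openin Y U \<Longrightarrow> openin (subtopology X B) (B \<inter> U)"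
  shows "subtopology X B = subtopology Y B"
proof -
  have "openin (subtopology Y B) S" if "openin (subtopology X B) S"
    "\<And>U. openin X U \<Longrightarrow> openin (subtopology Y B) (B \<inter> U)" for X Y :: "'a topology" and S
    using that by (auto simp: openin_subtopology Int_commute)
  with assms show ?thesis by (auto simp: topology_eq)
qed

lemma topspace_pointwise_topology [simp]: "topspace pointwise_topology = UNIV"
  by (auto simp: pointwise_topology_def topspace_pullback_topology)

lemma continuous_map_pointwise_eval:
  assumes "x \<in> ball 0 1"
  shows "continuous_map pointwise_topology euclidean (\<lambda>f. hollip_apply f x)"
proof -
  have "continuous_map (product_topology (\<lambda>_. euclidean) (ball 0 1)) euclidean (\<lambda>g. g x :: complex)"
    using assms by (rule continuous_map_product_projection)
  then have "continuous_map pointwise_topology euclidean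
      ((\<lambda>g. g x) \<circ> (\<lambda>f. restrict (hollip_apply f) (ball 0 1)))"
    unfolding pointwise_topology_def by (rule continuous_map_pullback)
  then show ?thesis using assms by (simp only: o_def restrict_apply' if_True)
qed

lemma openin_pointwise_finite_nhd:
  assumes "finite F" "F \<subseteq> ball 0 1"
  shows "openin pointwise_topology {g. \<forall>x\<in>F. dist (hollip_apply g x) (c x) < e}"
  using assms
proof (induction F)
  case empty
  show ?case using openin_topspace[of pointwise_topology] by simp
next
  case (insert x F)
  have "openin pointwise_topology {g \<in> topspace pointwise_topology. hollip_apply g x \<in> ball (c x) e}"
    using insert.prems by (intro openin_continuous_map_preimage[OF continuous_map_pointwise_eval]) auto
  then have "openin pointwise_topology {g. dist (hollip_apply g x) (c x) < e}"
    by (simp add: dist_commute)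
  from openin_Int[OF this insert.IH] show ?case
    using insert.prems by (simp add: Collect_conj_eq)
qed

lemma openin_pointwise_topology_imp_nhd:
  assumes U: "openin pointwise_topology U" "f \<in> U"
  obtains F e where "finite F" "F \<subseteq> ball 0 1" "e > 0"
    "{g. \<forall>x\<in>F. dist (hollip_apply g x) (hollip_apply f x) < e} \<subseteq> U"
proof -
  let ?r = "\<lambda>f. restrict (hollip_apply f) (ball 0 1)"
  obtain V where V: "openin (product_topology (\<lambda>_. euclidean) (ball 0 1)) V" "U = ?r -` V"
    using U(1) unfolding pointwise_topology_def openin_pullback_topology by auto
  have "?r f \<in> V" using U(2) V(2) by simp
  from product_topology_open_contains_basis[OF V(1) this] obtain W where
    W: "?r f \<in> (\<Pi>\<^sub>E x\<in>ball 0 1. W x)" "\<And>x. open (W x)" "finite {x. W x \<noteq> UNIV}"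
      "(\<Pi>\<^sub>E x\<in>ball 0 1. W x) \<subseteq> V" by auto
  define F where "F = {x \<in> ball 0 1. W x \<noteq> UNIV}"
  have F: "finite F" using W(3) by (rule finite_subset[rotated]) (auto simp: F_def)
  have fW: "hollip_apply f x \<in> W x" if "x \<in> F" for x
    using PiE_mem[OF W(1), of x] that by (simp add: F_def)
  have "\<forall>x. \<exists>e>0. x \<in> F \<longrightarrow> ball (hollip_apply f x) e \<subseteq> W x"
    using W(2) fW by (metis open_contains_ball zero_less_one)
  then obtain \<epsilon> where \<epsilon>: "\<And>x. \<epsilon> x > 0" "\<And>x. x \<in> F \<Longrightarrow> ball (hollip_apply f x) (\<epsilon> x) \<subseteq> W x"
    by metis
  define e where "e = Min (insert 1 (\<epsilon> ` F))"
  have e: "e > 0" "\<And>x. x \<in> F \<Longrightarrow> e \<le> \<epsilon> x" using F \<epsilon>(1) by (auto simp: e_def)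
  have "{g. \<forall>x\<in>F. dist (hollip_apply g x) (hollip_apply f x) < e} \<subseteq> U"
  proof
    fix g assume g: "g \<in> {g. \<forall>x\<in>F. dist (hollip_apply g x) (hollip_apply f x) < e}"
    have "hollip_apply g x \<in> W x" if "x \<in> ball 0 1" for x
    proof (cases "x \<in> F")
      case True
      then have "hollip_apply g x \<in> ball (hollip_apply f x) (\<epsilon> x)"
        using g e(2)[OF True] by (force simp: dist_commute)
      then show ?thesis using \<epsilon>(2)[OF True] by blast
    next
      case False
      then have "W x = UNIV" using that by (simp add: F_def)
      then show ?thesis by simp
    qed
    then have "?r g \<in> (\<Pi>\<^sub>E x\<in>ball 0 1. W x)" by (simp add: restrict_PiE_iff)
    then show "g \<in> U" using W(4) V(2) by blast
  qed
  moreover have "F \<subseteq> ball 0 1" by (auto simp: F_def)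
  ultimately show ?thesis using that F e(1) by blast
qed

text \<open>Maps of norm at most \<open>r\<close> are \<open>r\<close>-Lipschitz, so on a \<open>d\<close>-net of a compact set with
  \<open>r d \<le> e / 3\<close> a difference below \<open>e / 3\<close> spreads to a difference below \<open>e\<close> on the compact set.\<close>

lemma compact_convergence_subtopology_eq:
  "subtopology compact_convergence_topology (cball 0 r) = subtopology pointwise_topology (cball 0 r)"
proof (rule subtopology_eqI)
  fix U :: "('a, complex) hollip set" assume U: "openin pointwise_topology U"
  have "openin compact_convergence_topology U"
    unfolding openin_compact_convergence_topology
  proof
    fix f assume "f \<in> U"
    then obtain F e where "finite F" "F \<subseteq> ball 0 1" "e > 0"
      "{g. \<forall>x\<in>F. dist (hollip_apply g x) (hollip_apply f x) < e} \<subseteq> U"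
      using openin_pointwise_topology_imp_nhd[OF U] by blast
    then show "\<exists>K e. compact K \<and> K \<subseteq> ball 0 1 \<and> e > 0 \<and>
        {g. \<forall>x\<in>K. dist (hollip_apply g x) (hollip_apply f x) < e} \<subseteq> U"
      using finite_imp_compact by blast
  qed
  then show "openin (subtopology compact_convergence_topology (cball 0 r)) (cball 0 r \<inter> U)"
    by (rule openin_subtopology_Int2)
next
  fix U :: "('a, complex) hollip set" assume U: "openin compact_convergence_topology U"
  show "openin (subtopology pointwise_topology (cball 0 r)) (cball 0 r \<inter> U)"
  proof (subst openin_subopen, intro ballI)
    fix f assume f: "f \<in> cball 0 r \<inter> U"
    then obtain K e where K: "compact K" "K \<subseteq> ball 0 1" and e: "e > 0" and
      sub: "{g. \<forall>x\<in>K. dist (hollip_apply g x) (hollip_apply f x) < e} \<subseteq> U"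
      using U[unfolded openin_compact_convergence_topology, rule_format, of f] by auto
    have r: "r \<ge> 0" using f norm_ge_zero[of f] by (simp del: norm_ge_zero)
    have r1: "r + 1 > 0" using r by simp
    define d where "d = (e / 3) / (r + 1)"
    have d: "d > 0" "(r + 1) * d = e / 3" using e r1 by (simp_all add: d_def del: divide_divide_eq_left)
    then have rd: "r * d \<le> e / 3" by (simp add: distrib_right)
    from seq_compact_imp_totally_bounded[OF compact_imp_seq_compact[OF K(1)], rule_format, OF d(1)]
    obtain F where F: "finite F" "F \<subseteq> K" "K \<subseteq> (\<Union>k\<in>F. ball k d)" by metis
    define T where "T = {g. \<forall>x\<in>F. dist (hollip_apply g x) (hollip_apply f x) < e / 3}"
    have lip: "dist (hollip_apply g x) (hollip_apply g k) \<le> e / 3"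
      if "g \<in> cball 0 r" "x \<in> K" "k \<in> F" "dist k x < d" for g x k
    proof -
      have "dist (hollip_apply g x) (hollip_apply g k) \<le> lipschitz_const (hollip_apply g) * dist x k"
        using that K(2) F(2) by (intro lipschitz_onD[OF hollip_lipschitz]) blast+
      also have "\<dots> \<le> r * d"
      proof (rule mult_mono)
        show "lipschitz_const (hollip_apply g) \<le> r"
          using that(1) lipschitz_const_hollip_le_norm[of g] by simp
        show "dist x k \<le> d" using that(4) by (simp add: dist_commute)
      qed (use r in auto)
      finally show ?thesis using rd by linarith
    qed
    have "cball 0 r \<inter> T \<subseteq> cball 0 r \<inter> U"
    proof
      fix g assume g: "g \<in> cball 0 r \<inter> T"
      have "dist (hollip_apply g x) (hollip_apply f x) < e" if x: "x \<in> K" for x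
      proof -
        obtain k where k: "k \<in> F" "dist k x < d" using F(3) x by auto
        have "dist (hollip_apply g x) (hollip_apply g k) \<le> e / 3"
          "dist (hollip_apply f x) (hollip_apply f k) \<le> e / 3"
          using lip[OF _ x k] g f by blast+
        moreover have "dist (hollip_apply g k) (hollip_apply f k) < e / 3"
          using g k(1) by (simp add: T_def)
        ultimately show ?thesis
          using dist_triangle[of "hollip_apply g x" "hollip_apply f x" "hollip_apply g k"]
            dist_triangle2[of "hollip_apply g k" "hollip_apply f x" "hollip_apply f k"]
          by linarith
      qed
      then show "g \<in> cball 0 r \<inter> U" using g sub by blast
    qed
    moreover have "openin pointwise_topology T"
      unfolding T_def using F K(2) by (intro openin_pointwise_finite_nhd) auto
    then have "openin (subtopology pointwise_topology (cball 0 r)) (cball 0 r \<inter> T)"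
      by (rule openin_subtopology_Int2)
    moreover have "f \<in> cball 0 r \<inter> T" using f e by (simp add: T_def)
    ultimately show "\<exists>T. openin (subtopology pointwise_topology (cball 0 r)) T \<and> f \<in> T \<and>
        T \<subseteq> cball 0 r \<inter> U" by blast
  qed
qed

text \<open>Norm convergence of functionals is uniform convergence on bounded sets, and combinations of
  evaluations are continuous for pointwise convergence.\<close>

lemma continuous_map_predual_set_functional:
  assumes "\<phi> \<in> predual_set"
  shows "continuous_map (subtopology pointwise_topology (cball 0 r)) euclidean (clinfun_apply \<phi>)"
proof -
  define S where "S = {\<phi> :: ('a, complex) hollip \<Rightarrow>\<^sub>C\<^sub>L complex.
    continuous_map pointwise_topology euclidean (clinfun_apply \<phi>)}"
  have "complex_vector.subspace S"
  proof (rule complex_vector.subspaceI)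
    show "0 \<in> S" by (simp add: S_def zero_clinfun.rep_eq)
    show "\<phi> + \<psi> \<in> S" if "\<phi> \<in> S" "\<psi> \<in> S" for \<phi> \<psi>
      using that by (simp add: S_def plus_clinfun.rep_eq continuous_map_add)
    show "c *\<^sub>C \<phi> \<in> S" if "\<phi> \<in> S" for c \<phi>
    proof -
      have "continuous_map euclidean euclidean (\<lambda>z :: complex. c *\<^sub>C z)"
        using linear_continuous_on[OF scaleC_right_bounded_linear] by auto
      from continuous_map_compose[OF _ this] show ?thesis
        using that by (simp add: S_def scaleC_clinfun.rep_eq o_def)
    qed
  qed
  moreover have "eval_functional ` ball 0 1 \<subseteq> S"
    using continuous_map_pointwise_eval by (auto simp: S_def eval_functional.rep_eq)
  ultimately have span: "cspan (eval_functional ` ball 0 1) \<subseteq> S"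
    by (intro complex_vector.span_minimal)
  obtain \<Phi> where \<Phi>: "\<And>n. \<Phi> n \<in> cspan (eval_functional ` ball 0 1)" "\<Phi> \<longlonglongrightarrow> \<phi>"
    using assms unfolding predual_set_def by (auto simp: closure_sequential)
  show ?thesis
    unfolding mtopology_is_euclidean[symmetric]
  proof (rule Met_TC.continuous_map_uniform_limit_alt[where F = sequentially])
    show "\<forall>\<^sub>F n in sequentially. continuous_map (subtopology pointwise_topology (cball 0 r))
        Met_TC.mtopology (clinfun_apply (\<Phi> n))"
      using \<Phi>(1) span by (intro always_eventually allI)
        (auto simp: S_def intro: continuous_map_from_subtopology)
    fix e :: real assume e: "e > 0"
    have pos: "\<bar>r\<bar> + 1 > 0" by simp
    with e have "e / (\<bar>r\<bar> + 1) > 0" by simp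
    from tendstoD[OF \<Phi>(2) this]
    show "\<forall>\<^sub>F n in sequentially. \<forall>f\<in>topspace (subtopology pointwise_topology (cball 0 r)).
        dist (clinfun_apply (\<Phi> n) f) (clinfun_apply \<phi> f) < e"
    proof eventually_elim
      case (elim n)
      show ?case
      proof
        fix f :: "('a, complex) hollip" assume "f \<in> topspace (subtopology pointwise_topology (cball 0 r))"
        then have f: "norm f \<le> \<bar>r\<bar>" by simp
        have "dist (clinfun_apply (\<Phi> n) f) (clinfun_apply \<phi> f) \<le> norm (\<Phi> n - \<phi>) * norm f"
          using norm_clinfun[of "\<Phi> n - \<phi>" f] by (simp add: dist_norm minus_clinfun.rep_eq)
        also have "\<dots> \<le> e / (\<bar>r\<bar> + 1) * \<bar>r\<bar>"
          using elim f e by (intro mult_mono) (auto simp: dist_norm)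
        also have "\<dots> < e" using e by (simp add: pos_divide_less_eq[OF pos] distrib_left)
        finally show "dist (clinfun_apply (\<Phi> n) f) (clinfun_apply \<phi> f) < e" .
      qed
    qed
  qed auto
qed

text \<open>Evaluation at \<open>x\<close> is the pairing with \<open>\<delta> x\<close>, so \<open>w\<^sup>*\<close> is always finer than \<open>\<tau>\<^sub>p\<close>. The converse on
  bounded sets is the pointwise continuity there of every element of the predual.\<close>

lemma weak_star_subtopology_eq:
  "subtopology weak_star_topology (cball 0 r) =
    subtopology pointwise_topology (cball (0 :: ('a::complex_banach, complex) hollip) r)"
proof (rule subtopology_eqI)
  let ?ev = "\<lambda>f :: ('a, complex) hollip. clinfun_apply (linearization f)"
  have weak_star: "weak_star_topology =
      pullback_topology UNIV ?ev (product_topology (\<lambda>_. euclidean) UNIV)"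
    unfolding weak_star_topology_def dual_weak_star_topology_def topology_eq openin_pullback_topology
    by (auto simp: vimage_comp o_def)
  have cont: "continuous_map weak_star_topology euclidean (\<lambda>f. ?ev f p)" for p
    using continuous_map_pullback[OF continuous_map_product_projection[of p UNIV "\<lambda>_. euclidean"], of UNIV ?ev]
    by (simp add: weak_star o_def)
  fix U :: "('a, complex) hollip set"
  { assume U: "openin weak_star_topology U"
    then obtain W where W: "openin (product_topology (\<lambda>_. euclidean) UNIV) W" "U = ?ev -` W"
      unfolding weak_star openin_pullback_topology by auto
    have "continuous_map (subtopology pointwise_topology (cball 0 r))
        (product_topology (\<lambda>_. euclidean) UNIV) ?ev"
      unfolding continuous_map_componentwise_UNIV linearization_scalar
      by (intro allI continuous_map_predual_set_functional predual_functional)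
    note openin_continuous_map_preimage[OF this W(1)]
    also have "{f \<in> topspace (subtopology pointwise_topology (cball 0 r)). ?ev f \<in> W} = cball 0 r \<inter> U"
      by (auto simp: W(2))
    finally show "openin (subtopology pointwise_topology (cball 0 r)) (cball 0 r \<inter> U)" . }
  { assume U: "openin pointwise_topology U"
    let ?r = "\<lambda>f :: ('a, complex) hollip. restrict (hollip_apply f) (ball 0 1)"
    obtain V where V: "openin (product_topology (\<lambda>_. euclidean) (ball 0 1)) V" "U = ?r -` V"
      using U unfolding pointwise_topology_def openin_pullback_topology by auto
    have "continuous_map weak_star_topology euclidean (\<lambda>f. ?r f x)" if "x \<in> ball 0 1" for x
      using cont[of "delta x"] by (simp only: linearization_delta[OF that] restrict_apply' that)
    then have "continuous_map weak_star_topology (product_topology (\<lambda>_. euclidean) (ball 0 1)) ?r"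
      by (auto simp: continuous_map_componentwise)
    from openin_continuous_map_preimage[OF this V(1)]
    have "openin weak_star_topology U"
      by (simp add: V(2) vimage_def weak_star topspace_pullback_topology)
    then show "openin (subtopology weak_star_topology (cball 0 r)) (cball 0 r \<inter> U)"
      by (rule openin_subtopology_Int2) }
qed

section \<open>The predual as the functionals continuous on bounded sets\<close>

text \<open>Induction on the number of functionals: if some \<open>e\<close> is killed by all of \<open>F\<close> but not by \<open>g\<close>,
  subtracting from \<open>\<phi>\<close> the multiple of \<open>g\<close> that agrees with it at \<open>e\<close> leaves a functional
  vanishing on the common kernel of \<open>F\<close> alone.\<close>

lemma in_cspan_if_vanishes_on_common_kernel:
  fixes \<phi> :: "'a::complex_normed_vector \<Rightarrow>\<^sub>C\<^sub>L complex"
  assumes "finite F" and "\<And>x. (\<forall>g\<in>F. clinfun_apply g x = 0) \<Longrightarrow> clinfun_apply \<phi> x = 0"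
  shows "\<phi> \<in> cspan F"
  using assms
proof (induction F arbitrary: \<phi>)
  case empty
  then have "\<phi> = 0" by (intro clinfun_eqI) (simp add: zero_clinfun.rep_eq)
  then show ?case by (simp add: complex_vector.span_zero)
next
  case (insert g F)
  have lin: "clinfun_apply h (x - c *\<^sub>C y) = clinfun_apply h x - c * clinfun_apply h y"
    for h :: "'a \<Rightarrow>\<^sub>C\<^sub>L complex" and x y c
    by (simp add: clinfun_apply_diff clinfun_apply_scaleC scaleC_complex_def)
  have mono: "cspan F \<subseteq> cspan (insert g F)" by (rule complex_vector.span_mono) blast
  show ?case
  proof (cases "\<exists>x. (\<forall>h\<in>F. clinfun_apply h x = 0) \<and> clinfun_apply g x \<noteq> 0")
    case True
    then obtain e where e: "\<And>h. h \<in> F \<Longrightarrow> clinfun_apply h e = 0" "clinfun_apply g e \<noteq> 0" by blast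
    define c where "c = clinfun_apply \<phi> e / clinfun_apply g e"
    have "\<phi> - c *\<^sub>C g \<in> cspan F"
    proof (rule insert.IH)
      fix x assume x: "\<forall>h\<in>F. clinfun_apply h x = 0"
      have "clinfun_apply \<phi> (x - (clinfun_apply g x / clinfun_apply g e) *\<^sub>C e) = 0"
        by (rule insert.prems) (use x e in \<open>auto simp: lin\<close>)
      then show "clinfun_apply (\<phi> - c *\<^sub>C g) x = 0"
        by (simp add: lin c_def minus_clinfun.rep_eq scaleC_clinfun.rep_eq scaleC_complex_def
            mult.commute)
    qed
    then have "(\<phi> - c *\<^sub>C g) + c *\<^sub>C g \<in> cspan (insert g F)"
      using mono by (intro complex_vector.span_add complex_vector.span_scale)
        (auto intro: complex_vector.span_base)
    then show ?thesis by simp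
  next
    case False
    then have "\<phi> \<in> cspan F" by (intro insert.IH insert.prems) auto
    then show ?thesis using mono by blast
  qed
qed

text \<open>A pointwise neighbourhood of 0 in the ball constrains finitely many values, and contains every map
  of norm \<open>r\<close> vanishing at the points in question. So \<open>\<phi>\<close> is small in norm on a subspace of finite
  codimension; a small Hahn--Banach extension of that restriction is the error of approximating \<open>\<phi>\<close>
  by evaluations at these points.\<close>

lemma in_predual_set_if_pointwise_continuous:
  fixes \<phi> :: "('a::complex_normed_vector, complex) hollip \<Rightarrow>\<^sub>C\<^sub>L complex"
  assumes r: "r > 0" and cont: "continuous_map (subtopology pointwise_topology (cball 0 r))
    euclidean (clinfun_apply \<phi>)"
  shows "\<phi> \<in> predual_set"
  unfolding predual_set_def closure_approachable
proof (intro allI impI)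
  fix e :: real assume e: "e > 0"
  \<comment> \<open>A bound \<open>a\<close> on the sphere of radius \<open>r\<close> becomes, by homogeneity, the norm bound \<open>e / 2\<close>.\<close>
  define a where "a = e * r / 2"
  have a: "a > 0" using e r by (simp add: a_def)
  have "openin (subtopology pointwise_topology (cball 0 r))
      {f \<in> topspace (subtopology pointwise_topology (cball 0 r)). clinfun_apply \<phi> f \<in> ball 0 a}"
    by (rule openin_continuous_map_preimage[OF cont]) simp
  also have "{f \<in> topspace (subtopology pointwise_topology (cball 0 r)). clinfun_apply \<phi> f \<in> ball 0 a}
      = {f \<in> cball 0 r. cmod (clinfun_apply \<phi> f) < a}"
    by simp
  finally obtain U where U: "openin pointwise_topology U"
    "{f \<in> cball 0 r. cmod (clinfun_apply \<phi> f) < a} = U \<inter> cball 0 r"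
    unfolding openin_subtopology by metis
  then have U_iff: "f \<in> U \<longleftrightarrow> cmod (clinfun_apply \<phi> f) < a" if "norm f \<le> r" for f
    using that by (metis (mono_tags, lifting) IntD1 IntI mem_Collect_eq mem_cball_0)
  have "0 \<in> U"
    using r a by (simp add: U_iff clinfun_apply_zero)
  then obtain F d where F: "finite F" "F \<subseteq> ball 0 1" and d: "d > 0" and
    sub: "{g. \<forall>x\<in>F. dist (hollip_apply g x) (hollip_apply 0 x) < d} \<subseteq> U"
    using openin_pointwise_topology_imp_nhd[OF U(1)] by blast
  define N where "N = {f :: ('a, complex) hollip. \<forall>x\<in>F. hollip_apply f x = 0}"
  have N: "complex_vector.subspace N"
    by (rule complex_vector.subspaceI)
      (auto simp: N_def zero_hollip.rep_eq plus_hollip.rep_eq scaleC_hollip.rep_eq)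
  have le: "cmod (clinfun_apply \<phi> f) \<le> e / 2 * norm f" if f: "f \<in> N" for f
  proof (cases "f = 0")
    case False
    define c where "c = complex_of_real (r / norm f)"
    have c: "cmod c = r / norm f" using r unfolding c_def norm_of_real by simp
    have "c *\<^sub>C f \<in> N" using complex_vector.subspace_scale[OF N f] .
    then have "c *\<^sub>C f \<in> U"
      using d by (intro subsetD[OF sub]) (simp add: N_def zero_hollip.rep_eq)
    moreover have "norm (c *\<^sub>C f) = r" using False r by (simp add: c)
    ultimately have "cmod (clinfun_apply \<phi> (c *\<^sub>C f)) < a" using U_iff by simp
    then have "r / norm f * cmod (clinfun_apply \<phi> f) < a"
      by (simp add: clinfun_apply_scaleC c)
    then have "r * cmod (clinfun_apply \<phi> f) < r * (e / 2 * norm f)"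
      using False by (simp add: a_def pos_divide_less_eq mult_ac)
    then have "cmod (clinfun_apply \<phi> f) < e / 2 * norm f"
      using mult_less_cancel_left_pos[OF r] by blast
    then show ?thesis by simp
  qed (simp add: clinfun_apply_zero)
  obtain \<psi> where \<psi>: "norm \<psi> \<le> e / 2" "\<And>f. f \<in> N \<Longrightarrow> clinfun_apply \<psi> f = clinfun_apply \<phi> f"
    using clinfun_hahn_banach[OF N _ le] e by auto
  have "\<phi> - \<psi> \<in> cspan (eval_functional ` F)"
  proof (rule in_cspan_if_vanishes_on_common_kernel)
    fix f assume "\<forall>g\<in>eval_functional ` F. clinfun_apply g f = 0"
    then have "f \<in> N" by (simp add: N_def eval_functional.rep_eq)
    then show "clinfun_apply (\<phi> - \<psi>) f = 0" by (simp add: minus_clinfun.rep_eq \<psi>(2))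
  qed (use F in simp)
  then have "\<phi> - \<psi> \<in> cspan (eval_functional ` ball 0 1)"
    using complex_vector.span_mono[OF image_mono[OF F(2)]] by blast
  moreover have "dist (\<phi> - \<psi>) \<phi> < e" using \<psi>(1) e by (simp add: dist_norm)
  ultimately show "\<exists>\<eta>\<in>cspan (eval_functional ` ball 0 1). dist \<eta> \<phi> < e" by blast
qed

section \<open>Linearization of holomorphic Lipschitz maps\<close>

theorem proposition6p1:
  shows
    "(\<forall>f :: ('a::complex_banach, 'b::complex_banach) hollip.
        (\<exists>!T :: 'a predual \<Rightarrow>\<^sub>C\<^sub>L 'b. \<forall>x\<in>ball 0 1. hollip_apply f x = clinfun_apply T (delta x)) \<and>
        (\<forall>x\<in>ball 0 1. hollip_apply f x = clinfun_apply (linearization f) (delta x)) \<and>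
        1 / 2 * norm f \<le> max (lipschitz_const (hollip_apply f)) (norm (hollip_apply f 0)) \<and>
        max (lipschitz_const (hollip_apply f)) (norm (hollip_apply f 0)) \<le> norm (linearization f) \<and>
        norm (linearization f) \<le> norm f) \<and>
     surj (linearization :: ('a, 'b) hollip \<Rightarrow> 'a predual \<Rightarrow>\<^sub>C\<^sub>L 'b) \<and>
     Vector_Spaces.linear scaleC scaleC (linearization :: ('a, 'b) hollip \<Rightarrow> 'a predual \<Rightarrow>\<^sub>C\<^sub>L 'b) \<and>
     banach_isomorphism (linearization :: ('a, 'b) hollip \<Rightarrow> 'a predual \<Rightarrow>\<^sub>C\<^sub>L 'b) \<and>
     banach_isomorphism (linearization :: ('a, complex) hollip \<Rightarrow> 'a predual \<Rightarrow>\<^sub>C\<^sub>L complex) \<and>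
     (\<forall>r>0. let B = (*\<^sub>R) r ` cball (0 :: ('a, complex) hollip) 1 in
        subtopology weak_star_topology B = subtopology compact_convergence_topology B \<and>
        subtopology compact_convergence_topology B = subtopology pointwise_topology B) \<and>
     (\<forall>r>0. let B = (*\<^sub>R) r ` cball (0 :: ('a, complex) hollip) 1 in
        predual_set = {\<phi> :: ('a, complex) hollip \<Rightarrow>\<^sub>C\<^sub>L complex.
          continuous_map (subtopology compact_convergence_topology B) euclidean (clinfun_apply \<phi>)} \<and>
        predual_set = {\<phi> :: ('a, complex) hollip \<Rightarrow>\<^sub>C\<^sub>L complex.
          continuous_map (subtopology pointwise_topology B) euclidean (clinfun_apply \<phi>)})"
proof -
  have part_a: "(\<exists>!T :: 'a predual \<Rightarrow>\<^sub>C\<^sub>L 'b. \<forall>x\<in>ball 0 1. hollip_apply f x = clinfun_apply T (delta x)) \<and>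
      (\<forall>x\<in>ball 0 1. hollip_apply f x = clinfun_apply (linearization f) (delta x))"
    for f :: "('a, 'b) hollip"
  proof
    show delta: "\<forall>x\<in>ball 0 1. hollip_apply f x = clinfun_apply (linearization f) (delta x)"
      by (intro ballI linearization_delta[symmetric])
    show "\<exists>!T :: 'a predual \<Rightarrow>\<^sub>C\<^sub>L 'b. \<forall>x\<in>ball 0 1. hollip_apply f x = clinfun_apply T (delta x)"
      using delta linearization_eqI[of f] by (intro ex1I[of _ "linearization f"]) metis+
  qed
  note a = part_a[THEN conjunct1] part_a[THEN conjunct2]
  have ball: "(*\<^sub>R) r ` cball (0 :: ('a, complex) hollip) 1 = cball 0 r" if "r > 0" for r
    using that cball_scale[of r "0 :: ('a, complex) hollip" 1] by simp
  have c: "subtopology weak_star_topology ((*\<^sub>R) r ` cball (0 :: ('a, complex) hollip) 1) =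
      subtopology compact_convergence_topology ((*\<^sub>R) r ` cball 0 1)"
    "subtopology compact_convergence_topology ((*\<^sub>R) r ` cball (0 :: ('a, complex) hollip) 1) =
      subtopology pointwise_topology ((*\<^sub>R) r ` cball 0 1)" if "r > 0" for r
    by (simp_all only: ball[OF that] weak_star_subtopology_eq compact_convergence_subtopology_eq)
  have d: "predual_set = {\<phi> :: ('a, complex) hollip \<Rightarrow>\<^sub>C\<^sub>L complex.
      continuous_map (subtopology pointwise_topology ((*\<^sub>R) r ` cball 0 1)) euclidean
        (clinfun_apply \<phi>)}" if "r > 0" for r
    unfolding ball[OF that]
    using continuous_map_predual_set_functional in_predual_set_if_pointwise_continuous[OF that]
    by blast
  have d': "predual_set = {\<phi> :: ('a, complex) hollip \<Rightarrow>\<^sub>C\<^sub>L complex.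
      continuous_map (subtopology compact_convergence_topology ((*\<^sub>R) r ` cball 0 1)) euclidean
        (clinfun_apply \<phi>)}" if "r > 0" for r
    unfolding c(2)[OF that] by (rule d[OF that])
  show ?thesis
    unfolding Let_def
    by (intro conjI allI impI; (rule a half_norm_hollip_le_max max_le_norm_linearization
        norm_linearization_le surj_linearization linear_linearization
        banach_isomorphism_linearization c d d'; assumption?))
qed

end
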